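(* Let $M^3\subset\mathbb{C}^2$ be a connected real hypersurface belonging to the General Class I, of smoothness $\mathcal{C}^\kappa$ with $\kappa\geqslant 3$, or $\mathcal{C}^\infty$, or $\mathcal{C}^\omega$, with its biholomorphically invariant $(1,0)$ CR bundle $T^{1,0}M\subset\mathbb{C}\otimes_{\mathbb{R}}TM$. For any choice of local vector field generator $\mathcal{L}$ of $T^{1,0}M$, the associated triple $$\big\{\mathcal{L},\ \overline{\mathcal{L}},\ \mathcal{T}\big\},\qquad \mathcal{T}:=\sqrt{-1}\,[\mathcal{L},\overline{\mathcal{L}}],$$ is a local frame for $\mathbb{C}\otimes_{\mathbb{R}}TM$, and these frames perform a reduction of the full $\mathsf{GL}_3(\mathbb{C})$-structure of $\mathbb{C}\otimes_{\mathbb{R}}TM$ to the subgroup of real dimension $4$ $$\mathsf{G}_{\mathsf{I}}^{\mathsf{initial}}:=\left\{\begin{pmatrix}\mathsf{a}&0&0\\0&\overline{\mathsf{a}}&0\\ \mathsf{b}&\overline{\mathsf{b}}&\mathsf{a}\overline{\mathsf{a}}\end{pmatrix}:\ \mathsf{a}\in\mathbb{C}\setminus\{0\},\ \mathsf{b}\in\mathbb{C}\right\}\subset\mathsf{GL}_3(\mathbb{C}).$$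
   Context: For a real submanifold $M\subset\mathbb{C}^n$, $T^{1,0}M\subset\mathbb{C}\otimes_{\mathbb{R}}TM$ is the bundle of $(1,0)$ vectors tangent to $M$ and $T^{0,1}M=\overline{T^{1,0}M}$. For a real hypersurface $M^3\subset\mathbb{C}^2$, $T^{1,0}M$ has complex rank $1$; a local generator $\mathcal{L}$ is a nowhere vanishing local section, taken of the natural smoothness of the bundle ($\mathcal{C}^{\kappa-1}$, resp. $\mathcal{C}^\infty$, $\mathcal{C}^\omega$). General Class I: $M^3\subset\mathbb{C}^2$ belongs to it if $\mathbb{C}\otimes_{\mathbb{R}}TM=T^{1,0}M+T^{0,1}M+[T^{1,0}M,T^{0,1}M]$, i.e. for any local generator $\mathcal{L}$ of $T^{1,0}M$, the vectors $\mathcal{L}|_q,\overline{\mathcal{L}}|_q,[\mathcal{L},\overline{\mathcal{L}}]|_q$ have complex rank $3$ at every point $q$ where $\mathcal{L}$ is defined. "These frames perform a reduction of the full $\mathsf{GL}$-structure to a subgroup $\mathsf{G}$" means: $\mathsf{G}$ is a closed subgroup of the general linear group, and for any two local generators defined on a common open subset $V\subset M$, the two associated frames, written as column vectors, are related at each point of $V$ by left multiplication by a matrix belonging to $\mathsf{G}$ (with entries functions on $V$). *)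

theory Defs
  imports "HOL-Analysis.Analysis" "HOL-Algebra.Group"
begin

section \<open>Smoothness classes\<close>

datatype smoothness = C_fin nat | C_infinity | C_omega

text \<open>Loss of \<open>j\<close> derivatives, with the conventions \<open>\<infinity> - j = \<infinity>\<close> and \<open>\<omega> - j = \<omega>\<close>.\<close>

fun lose_derivs :: "nat \<Rightarrow> smoothness \<Rightarrow> smoothness" where
  "lose_derivs j (C_fin k) = C_fin (k - j)"
| "lose_derivs j C_infinity = C_infinity"
| "lose_derivs j C_omega = C_omega"

fun at_least_C :: "nat \<Rightarrow> smoothness \<Rightarrow> bool" where
  "at_least_C j (C_fin k) \<longleftrightarrow> j \<le> k"
| "at_least_C j C_infinity \<longleftrightarrow> True"
| "at_least_C j C_omega \<longleftrightarrow> True"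

text \<open>The notions \<open>Ck_on\<close>, \<open>analytic_real_on\<close> and \<open>of_class\<close> are meant for an open set \<open>U\<close>.\<close>

primrec Ck_on :: "nat \<Rightarrow> ('a::euclidean_space \<Rightarrow> 'b::euclidean_space) \<Rightarrow> 'a set \<Rightarrow> bool" where
  "Ck_on 0 f U \<longleftrightarrow> continuous_on U f"
| "Ck_on (Suc k) f U \<longleftrightarrow>
    (\<exists>f'. (\<forall>x\<in>U. (f has_derivative f' x) (at x)) \<and> (\<forall>v. Ck_on k (\<lambda>x. f' x v) U))"

text \<open>Real analyticity: smooth, and near each point the sum of a power series. The multi-indices
  are the functions from the standard basis to the naturals.\<close>

definition analytic_real_on :: "('a::euclidean_space \<Rightarrow> 'b::euclidean_space) \<Rightarrow> 'a set \<Rightarrow> bool" where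
  "analytic_real_on f U \<longleftrightarrow> (\<forall>k. Ck_on k f U) \<and>
    (\<forall>x\<in>U. \<exists>c r. 0 < r \<and> (\<forall>y\<in>ball x r.
      ((\<lambda>\<alpha>. (\<Prod>b\<in>Basis. ((y - x) \<bullet> b) ^ \<alpha> b) *\<^sub>R c \<alpha>) has_sum f y)
        (Basis \<rightarrow>\<^sub>E (UNIV :: nat set))))"

fun of_class :: "smoothness \<Rightarrow> ('a::euclidean_space \<Rightarrow> 'b::euclidean_space) \<Rightarrow> 'a set \<Rightarrow> bool" where
  "of_class (C_fin k) f U \<longleftrightarrow> Ck_on k f U"
| "of_class C_infinity f U \<longleftrightarrow> (\<forall>k. Ck_on k f U)"
| "of_class C_omega f U \<longleftrightarrow> analytic_real_on f U"

text \<open>Functions on a subset \<open>V\<close> of the ambient space (in practice a relatively open piece of a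
  submanifold): they are of a given class if they have ambient extensions of that class locally.\<close>

definition of_class_sub ::
    "smoothness \<Rightarrow> ('a::euclidean_space \<Rightarrow> 'b::euclidean_space) \<Rightarrow> 'a set \<Rightarrow> bool" where
  "of_class_sub \<kappa> f V \<longleftrightarrow>
    (\<forall>q\<in>V. \<exists>U g. open U \<and> q \<in> U \<and> of_class \<kappa> g U \<and> (\<forall>x\<in>U \<inter> V. g x = f x))"


section \<open>Submanifolds of Euclidean spaces\<close>

text \<open>Embedded real submanifolds of dimension \<open>d\<close>, by slice charts.\<close>

definition submanifold :: "smoothness \<Rightarrow> nat \<Rightarrow> ('a::euclidean_space) set \<Rightarrow> bool" where
  "submanifold \<kappa> d S \<longleftrightarrow>
    (\<forall>p\<in>S. \<exists>U (W :: 'a set) \<phi> \<psi> E. open U \<and> p \<in> U \<and> open W \<and> homeomorphism U W \<phi> \<psi> \<and>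
       of_class \<kappa> \<phi> U \<and> of_class \<kappa> \<psi> W \<and>
       subspace E \<and> dim E = d \<and> \<phi> ` (S \<inter> U) = E \<inter> W)"

definition tangent_space :: "('a::euclidean_space) set \<Rightarrow> 'a \<Rightarrow> 'a set" where
  "tangent_space S q =
    {v. \<exists>\<gamma> \<epsilon>. 0 < \<epsilon> \<and> \<gamma> C1_differentiable_on {-\<epsilon><..<\<epsilon>} \<and> \<gamma> ` {-\<epsilon><..<\<epsilon>} \<subseteq> S \<and>
       \<gamma> 0 = q \<and> (\<gamma> has_vector_derivative v) (at 0)}"

definition real_hypersurface :: "smoothness \<Rightarrow> (complex^2) set \<Rightarrow> bool" where
  "real_hypersurface \<kappa> M \<longleftrightarrow> submanifold \<kappa> 3 M"


section \<open>Complexified tangent vectors\<close>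

text \<open>The complexification of a real vector space \<open>E\<close> is realized as \<open>E \<times> E\<close>, the pair \<open>(X, Y)\<close>
  standing for \<open>X + \<i> Y\<close>.\<close>

type_synonym 'a complexified = "'a \<times> 'a"

definition scaleC :: "complex \<Rightarrow> 'a::real_vector complexified \<Rightarrow> 'a complexified"
    (infixr \<open>*\<^sub>C\<close> 75) where
  "c *\<^sub>C v = (Re c *\<^sub>R fst v - Im c *\<^sub>R snd v, Re c *\<^sub>R snd v + Im c *\<^sub>R fst v)"

definition conjC :: "'a::real_vector complexified \<Rightarrow> 'a complexified" where
  "conjC v = (fst v, - snd v)"

interpretation cpx: vector_space "scaleC :: complex \<Rightarrow> 'a::real_vector complexified \<Rightarrow> _"
  by unfold_locales (auto simp: scaleC_def algebra_simps)

definition CT :: "('a::euclidean_space) set \<Rightarrow> 'a \<Rightarrow> 'a complexified set" where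
  "CT M q = tangent_space M q \<times> tangent_space M q"

text \<open>\<open>T\<^sup>1\<^sup>,\<^sup>0M\<close>: the \<open>\<i>\<close>-eigenspace in \<open>\<complex> \<otimes> TM\<close> of the complex-linear extension of the
  complex structure \<open>X \<mapsto> \<i> X\<close> of \<open>\<complex>\<^sup>2\<close>.\<close>

definition T10 :: "(complex^2) set \<Rightarrow> complex^2 \<Rightarrow> (complex^2) complexified set" where
  "T10 M q = {v \<in> CT M q. map_prod ((*s) \<i>) ((*s) \<i>) v = \<i> *\<^sub>C v}"

text \<open>Brackets of vector fields tangent to a submanifold \<open>M\<close> and defined near \<open>q\<close> on \<open>M\<close> only.
  The derivative at \<open>q\<close> within \<open>M\<close> is a choice, but its values on vectors tangent to \<open>M\<close>, where
  alone it is evaluated, do not depend on that choice, nor on the fields away from \<open>q\<close>.\<close>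

definition lie_bracket :: "('a::euclidean_space) set \<Rightarrow> ('a \<Rightarrow> 'a) \<Rightarrow> ('a \<Rightarrow> 'a) \<Rightarrow> 'a \<Rightarrow> 'a" where
  "lie_bracket M X Y q =
    frechet_derivative Y (at q within M) (X q) - frechet_derivative X (at q within M) (Y q)"

text \<open>The complex-bilinear extension of the bracket.\<close>

definition lie_bracketC :: "('a::euclidean_space) set \<Rightarrow>
    ('a \<Rightarrow> 'a complexified) \<Rightarrow> ('a \<Rightarrow> 'a complexified) \<Rightarrow> 'a \<Rightarrow> 'a complexified" where
  "lie_bracketC M K L q =
    (lie_bracket M (fst \<circ> K) (fst \<circ> L) q - lie_bracket M (snd \<circ> K) (snd \<circ> L) q,
     lie_bracket M (fst \<circ> K) (snd \<circ> L) q + lie_bracket M (snd \<circ> K) (fst \<circ> L) q)"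


section \<open>Local generators, General Class I and frames\<close>

definition local_generator :: "smoothness \<Rightarrow> (complex^2) set \<Rightarrow> (complex^2) set \<Rightarrow>
    (complex^2 \<Rightarrow> (complex^2) complexified) \<Rightarrow> bool" where
  "local_generator \<kappa> M V L \<longleftrightarrow> openin (top_of_set M) V \<and>
    of_class_sub (lose_derivs 1 \<kappa>) L V \<and> (\<forall>q\<in>V. L q \<in> T10 M q \<and> L q \<noteq> 0)"

definition general_class_I :: "smoothness \<Rightarrow> (complex^2) set \<Rightarrow> bool" where
  "general_class_I \<kappa> M \<longleftrightarrow>
    (\<forall>V L. local_generator \<kappa> M V L \<longrightarrow>
      (\<forall>q\<in>V. cpx.dim {L q, conjC (L q), lie_bracketC M L (conjC \<circ> L) q} = 3))"

text \<open>The bracket costs one derivative more than the generator: for \<open>M\<close> of class \<open>C\<^sup>\<kappa>\<close> the third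
  field below is in general only of class \<open>C\<^sup>\<kappa>\<^sup>-\<^sup>2\<close>.\<close>

definition cr_frame :: "(complex^2) set \<Rightarrow> (complex^2 \<Rightarrow> (complex^2) complexified) \<Rightarrow>
    complex^2 \<Rightarrow> ((complex^2) complexified)^3" where
  "cr_frame M L q = vector [L q, conjC (L q), \<i> *\<^sub>C lie_bracketC M L (conjC \<circ> L) q]"

definition local_frame :: "smoothness \<Rightarrow> ('a::euclidean_space) set \<Rightarrow> 'a set \<Rightarrow>
    ('a \<Rightarrow> ('a complexified)^'n) \<Rightarrow> bool" where
  "local_frame \<kappa> M V F \<longleftrightarrow> openin (top_of_set M) V \<and>
    (\<forall>i. of_class_sub \<kappa> (\<lambda>q. F q $ i) V) \<and>
    (\<forall>q\<in>V. inj (($) (F q)) \<and> cpx.independent (range (($) (F q))) \<and>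
       cpx.span (range (($) (F q))) = CT M q)"


section \<open>Reduction of the structure group\<close>

definition GL :: "(complex^'n^'n) monoid" where
  "GL = \<lparr>carrier = {A. invertible A}, monoid.mult = (**), one = mat 1\<rparr>"

definition closed_subgroup_GL :: "(complex^'n^'n) set \<Rightarrow> bool" where
  "closed_subgroup_GL G \<longleftrightarrow> subgroup G GL \<and> closedin (top_of_set (carrier GL)) G"

text \<open>Left multiplication of a column of complexified vectors by a complex matrix.\<close>

definition matrix_frame_mult :: "complex^'n^'m \<Rightarrow> ('a::real_vector complexified)^'n \<Rightarrow>
    ('a complexified)^'m" where
  "matrix_frame_mult A F = (\<chi> i. \<Sum>j\<in>UNIV. (A $ i $ j) *\<^sub>C (F $ j))"

definition cr_frames_reduce_to :: "smoothness \<Rightarrow> (complex^2) set \<Rightarrow> (complex^3^3) set \<Rightarrow> bool" where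
  "cr_frames_reduce_to \<kappa> M G \<longleftrightarrow> closed_subgroup_GL G \<and>
    (\<forall>V L L'. local_generator \<kappa> M V L \<and> local_generator \<kappa> M V L' \<longrightarrow>
      (\<exists>g. \<forall>q\<in>V. g q \<in> G \<and> cr_frame M L' q = matrix_frame_mult (g q) (cr_frame M L q)))"

definition G_I_initial :: "(complex^3^3) set" where
  "G_I_initial =
    {vector [vector [a, 0, 0],
             vector [0, cnj a, 0],
             vector [b, cnj b, a * cnj a]] | a b. a \<noteq> 0}"

end

theory Submission
  imports Defs
begin

text \<open>In a slice chart \<open>\<phi>\<close> of \<open>M\<close>, with \<open>\<phi>(M)\<close> in a linear subspace \<open>E\<close>, a vector is tangent to \<open>M\<close> at \<open>q\<close> iff
  \<open>D\<phi>\<^sub>q\<close> maps it to \<open>E\<close>. Differentiating \<open>D\<phi>(X)\<close> along \<open>Y\<close> and \<open>D\<phi>(Y)\<close> along \<open>X\<close> inside \<open>E\<close> and subtracting,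
  the symmetry of \<open>D\<^sup>2\<phi>\<close> leaves \<open>D\<phi>([X, Y])\<close> in \<open>E\<close>, so the bracket of tangent fields is tangent. Hence \<open>L\<close>,
  its conjugate and \<open>T\<close> are three independent vectors of the complex three-dimensional space \<open>\<complex> \<otimes> T\<^sub>qM\<close>.
  A real hyperplane of \<open>\<complex>\<^sup>2\<close> contains at most one complex line, so two generators satisfy \<open>L' = a L\<close>, and the
  Leibniz rule for \<open>[a L, cnj (a L)]\<close> gives \<open>T' = a cnj a T + b L + cnj b cnj L\<close>.
  The regularity of the frame requires that each smoothness class is stable under products and partial
  derivatives; in the analytic case this is the Cauchy product and the termwise differentiation of power series.\<close>

section \<open>Calculus of the smoothness classes\<close>

text \<open>The fields live on \<open>M\<close> alone, and \<open>lie_bracket\<close> uses a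
  derivative within \<open>M\<close> whose values off the tangent space are arbitrary. Everything
  therefore passes through ambient extensions. A tangent vector is the velocity of a curve in
  \<open>M\<close>, so the derivative along it depends only on the values on \<open>M\<close>;
  brackets can then be computed by the coordinate formula \<open>DY X - DX Y\<close>, and the same
  formula supplies the ambient extension that the regularity of the third frame field asks for. No
  coordinates on \<open>M\<close> enter the change of generator: \<open>a\<close> is the quotient of
  one coordinate of the two extensions, hence differentiable at \<open>q\<close>. The coefficient of
  \<open>L\<close> in the new bracket is, up to sign, the derivative of \<open>a\<close> along the
  conjugate of \<open>L'\<close>. The bracket of a field with its conjugate changes sign under
  conjugation, so the coefficient of the conjugate of \<open>L\<close> is then forced; the factor
  \<i> in \<open>T\<close> turns this antisymmetry into the pair \<open>b\<close>,
  \<open>cnj b\<close>.\<close>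

lemma Ck_on_Suc_D:
  assumes "Ck_on (Suc k) f U"
  shows "Ck_on k f U"
  using assms
proof (induction k arbitrary: f)
  case 0
  then show ?case
    by (auto intro!: continuous_at_imp_continuous_on dest: has_derivative_continuous)
next
  case (Suc k)
  from Suc.prems obtain f' where f': "\<forall>x\<in>U. (f has_derivative f' x) (at x)"
    "\<forall>v. Ck_on (Suc k) (\<lambda>x. f' x v) U"
    unfolding Ck_on.simps(2)[of "Suc k"] by blast
  then have "\<forall>v. Ck_on k (\<lambda>x. f' x v) U"
    using Suc.IH by blast
  with f' show ?case
    unfolding Ck_on.simps(2)[of k] by blast
qed

lemma Ck_on_antimono: "Ck_on k f U \<Longrightarrow> j \<le> k \<Longrightarrow> Ck_on j f U"
  by (induction k) (auto simp: le_Suc_eq simp del: Ck_on.simps dest: Ck_on_Suc_D)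

lemma Ck_on_subset: "Ck_on k f U \<Longrightarrow> V \<subseteq> U \<Longrightarrow> Ck_on k f V"
  by (induction k arbitrary: f) (auto intro: continuous_on_subset, blast)

lemma Ck_on_imp_continuous_on: "Ck_on k f U \<Longrightarrow> continuous_on U f"
  using Ck_on_antimono[of k f U 0] by simp

lemma Ck_on_const: "Ck_on k (\<lambda>x. c) U"
proof (induction k arbitrary: c)
  case (Suc k)
  then show ?case
    by (auto intro!: exI[of _ "\<lambda>x v. 0"])
qed auto

lemma Ck_on_ident: "Ck_on k (\<lambda>x. x) U"
  by (cases k) (auto intro!: exI[of _ "\<lambda>x v. v"] Ck_on_const)

lemma Ck_on_add:
  assumes "Ck_on k f U" "Ck_on k g U"
  shows "Ck_on k (\<lambda>x. f x + g x) U"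
  using assms
proof (induction k arbitrary: f g)
  case 0
  then show ?case by (auto intro: continuous_intros)
next
  case (Suc k)
  from Suc.prems obtain f' g' where
    "\<forall>x\<in>U. (f has_derivative f' x) (at x)" "\<forall>v. Ck_on k (\<lambda>x. f' x v) U"
    "\<forall>x\<in>U. (g has_derivative g' x) (at x)" "\<forall>v. Ck_on k (\<lambda>x. g' x v) U"
    by auto
  then show ?case
    using Suc.IH by (auto intro!: exI[of _ "\<lambda>x v. f' x v + g' x v"] has_derivative_add)
qed

lemma Ck_on_bounded_linear:
  assumes "bounded_linear h" "Ck_on k f U"
  shows "Ck_on k (\<lambda>x. h (f x)) U"
  using assms(2)
proof (induction k arbitrary: f)
  case 0
  then show ?case using assms(1) by (auto intro: bounded_linear.continuous_on)
next
  case (Suc k)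
  from Suc.prems obtain f' where
    "\<forall>x\<in>U. (f has_derivative f' x) (at x)" "\<forall>v. Ck_on k (\<lambda>x. f' x v) U"
    by auto
  then show ?case
    using Suc.IH
    by (auto intro!: exI[of _ "\<lambda>x v. h (f' x v)"] bounded_linear.has_derivative[OF assms(1)])
qed

lemma Ck_on_bounded_bilinear:
  assumes "bounded_bilinear h" "Ck_on k f U" "Ck_on k g U"
  shows "Ck_on k (\<lambda>x. h (f x) (g x)) U"
  using assms(2,3)
proof (induction k arbitrary: f g)
  case 0
  then show ?case using assms(1) by (auto intro: bounded_bilinear.continuous_on)
next
  case (Suc k)
  from Suc.prems obtain f' g' where
    *: "\<forall>x\<in>U. (f has_derivative f' x) (at x)" "\<forall>v. Ck_on k (\<lambda>x. f' x v) U"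
    "\<forall>x\<in>U. (g has_derivative g' x) (at x)" "\<forall>v. Ck_on k (\<lambda>x. g' x v) U"
    by auto
  have "Ck_on k f U" "Ck_on k g U"
    using Suc.prems by (auto dest: Ck_on_Suc_D simp del: Ck_on.simps)
  with * show ?case
    using Suc.IH
    by (auto intro!: exI[of _ "\<lambda>x v. h (f x) (g' x v) + h (f' x v) (g x)"] Ck_on_add
        bounded_bilinear.FDERIV[OF assms(1)])
qed

text \<open>Openness of \<open>U\<close> is what lets agreement on \<open>U\<close> pass to the
  derivatives, which \<open>Ck_on\<close> takes in full neighbourhoods.\<close>

lemma Ck_on_cong:
  assumes "open U" "\<And>x. x \<in> U \<Longrightarrow> f x = g x" "Ck_on k f U"
  shows "Ck_on k g U"
proof (cases k)
  case 0
  with assms show ?thesis using continuous_on_cong by fastforce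
next
  case (Suc j)
  with assms(3) obtain f' where
    "\<And>x. x \<in> U \<Longrightarrow> (f has_derivative f' x) (at x)" "\<And>v. Ck_on j (\<lambda>x. f' x v) U"
    by auto
  then show ?thesis
    unfolding Suc using assms(1,2)
    by (auto intro!: exI[of _ f'] has_derivative_transform_within_open[of f _ _ _ U g])
qed

text \<open>The second difference of \<open>f\<close> over the parallelogram spanned by
  \<open>t v\<close> and \<open>t w\<close> is symmetric in \<open>v\<close> and \<open>w\<close>.
  Two applications of the mean value theorem turn it into \<open>t * t\<close> times a mixed second
  derivative at a nearby point, in either order; then \<open>t\<close> tends to 0. Continuity is
  asked only of the two directional second derivatives, which is what \<open>Ck_on\<close>
  provides.\<close>

lemma schwarz_real:
  fixes f :: "'a::real_normed_vector \<Rightarrow> real"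
  assumes "open U" "q \<in> U"
    and f': "\<And>x. x \<in> U \<Longrightarrow> (f has_derivative f' x) (at x)"
    and g': "\<And>x. x \<in> U \<Longrightarrow> ((\<lambda>x. f' x v) has_derivative g' x) (at x)"
    and h': "\<And>x. x \<in> U \<Longrightarrow> ((\<lambda>x. f' x w) has_derivative h' x) (at x)"
    and g'c: "continuous_on U (\<lambda>x. g' x w)"
    and h'c: "continuous_on U (\<lambda>x. h' x v)"
  shows "g' q w = h' q v"
proof -
  \<comment> \<open>Stated for arbitrary directions and an arbitrary \<open>g'\<close>, so that it
    can be used a second time with \<open>v\<close> and \<open>w\<close> exchanged.\<close>
  have diff_quot: "\<exists>\<xi>. dist \<xi> q \<le> t * (norm v + norm w) \<and>
      f (q + t *\<^sub>R v + t *\<^sub>R w) - f (q + t *\<^sub>R v) - f (q + t *\<^sub>R w) + f q = t * t * g' \<xi> w"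
    if t: "0 < t" "cball q (t * (norm v + norm w)) \<subseteq> U"
      and g': "\<And>x. x \<in> U \<Longrightarrow> ((\<lambda>x. f' x v) has_derivative g' x) (at x)" for t g' v w
  proof -
    have inU: "q + s *\<^sub>R v + r *\<^sub>R w \<in> cball q (t * (norm v + norm w))"
      if "0 \<le> s" "s \<le> t" "0 \<le> r" "r \<le> t" for s r
    proof -
      have "norm (s *\<^sub>R v + r *\<^sub>R w) \<le> s * norm v + r * norm w"
        using that by (metis abs_of_nonneg norm_scaleR norm_triangle_ineq)
      also have "\<dots> \<le> t * norm v + t * norm w"
        using that by (intro add_mono mult_right_mono) auto
      finally show ?thesis
        by (auto simp: dist_norm algebra_simps norm_minus_commute)
    qed
    \<comment> \<open>The increment in direction \<open>w\<close> as a function of the position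
      along \<open>v\<close>. The mean value theorem in \<open>s\<close> yields a difference of
      first derivatives, and its use in \<open>r\<close> below a second derivative.\<close>
    let ?k = "\<lambda>s. f (q + s *\<^sub>R v + t *\<^sub>R w) - f (q + s *\<^sub>R v)"
    have dk: "(?k has_derivative (\<lambda>d. f' (q + s *\<^sub>R v + t *\<^sub>R w) (d *\<^sub>R v) - f' (q + s *\<^sub>R v) (d *\<^sub>R v)))
        (at s within {0..t})" if "0 \<le> s" "s \<le> t" for s
    proof -
      have U: "q + s *\<^sub>R v + t *\<^sub>R w \<in> U" "q + s *\<^sub>R v \<in> U"
        using inU[of s t] inU[of s 0] that t by auto
      have d: "((\<lambda>s. q + s *\<^sub>R v + t *\<^sub>R w) has_derivative (\<lambda>d. d *\<^sub>R v)) (at s within {0..t})"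
        "((\<lambda>s. q + s *\<^sub>R v) has_derivative (\<lambda>d. d *\<^sub>R v)) (at s within {0..t})"
        by (auto intro!: derivative_eq_intros)
      show ?thesis
        by (rule has_derivative_diff[OF has_derivative_compose[OF d(1) f'[OF U(1)]]
              has_derivative_compose[OF d(2) f'[OF U(2)]]])
    qed
    obtain s where s: "s \<in> {0<..<t}"
      "?k t - ?k 0 = f' (q + s *\<^sub>R v + t *\<^sub>R w) ((t - 0) *\<^sub>R v) - f' (q + s *\<^sub>R v) ((t - 0) *\<^sub>R v)"
      using mvt_simple[OF t(1) dk] by blast
    have linear: "linear (f' x)" if "x \<in> U" for x
      using f'[OF that] has_derivative_linear by blast
    have "q + s *\<^sub>R v + t *\<^sub>R w \<in> U" "q + s *\<^sub>R v \<in> U"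
      using inU[of s t] inU[of s 0] s(1) t by auto
    with s(2) linear have s2: "?k t - ?k 0 = t * (f' (q + s *\<^sub>R v + t *\<^sub>R w) v - f' (q + s *\<^sub>R v) v)"
      by (auto simp: linear_cmul algebra_simps)
    let ?m = "\<lambda>r. f' (q + s *\<^sub>R v + r *\<^sub>R w) v"
    have dm: "(?m has_derivative (\<lambda>d. g' (q + s *\<^sub>R v + r *\<^sub>R w) (d *\<^sub>R w))) (at r within {0..t})"
      if "0 \<le> r" "r \<le> t" for r
    proof -
      have U: "q + s *\<^sub>R v + r *\<^sub>R w \<in> U"
        using inU[of s r] that t s(1) by auto
      have d: "((\<lambda>r. q + s *\<^sub>R v + r *\<^sub>R w) has_derivative (\<lambda>d. d *\<^sub>R w)) (at r within {0..t})"
        by (auto intro!: derivative_eq_intros)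
      show ?thesis
        by (rule has_derivative_compose[OF d g'[OF U]])
    qed
    obtain r where r: "r \<in> {0<..<t}"
      "?m t - ?m 0 = g' (q + s *\<^sub>R v + r *\<^sub>R w) ((t - 0) *\<^sub>R w)"
      using mvt_simple[OF t(1) dm] by blast
    let ?\<xi> = "q + s *\<^sub>R v + r *\<^sub>R w"
    have \<xi>: "?\<xi> \<in> cball q (t * (norm v + norm w))"
      using inU[of s r] r(1) s(1) by auto
    then have "linear (g' ?\<xi>)"
      using t g' has_derivative_linear by blast
    with r s2 have "?k t - ?k 0 = t * t * g' ?\<xi> w"
      by (simp add: linear_cmul)
    with \<xi> show ?thesis
      by (intro exI[of _ ?\<xi>]) (auto simp: dist_commute)
  qed
  have "\<bar>g' q w - h' q v\<bar> \<le> e" if "e > 0" for e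
  proof -
    have "isCont (\<lambda>x. g' x w) q" "isCont (\<lambda>x. h' x v) q"
      using g'c h'c assms(1,2) continuous_on_eq_continuous_at by blast+
    note cont = this[unfolded continuous_at_eps_delta dist_real_def, rule_format, OF half_gt_zero[OF that]]
    from cont(1) obtain d1 where d1: "d1 > 0" "\<And>x. dist x q < d1 \<Longrightarrow> \<bar>g' x w - g' q w\<bar> < e/2"
      by blast
    from cont(2) obtain d2 where d2: "d2 > 0" "\<And>x. dist x q < d2 \<Longrightarrow> \<bar>h' x v - h' q v\<bar> < e/2"
      by blast
    note d = d1 d2
    from assms(1,2) obtain d3 where d3: "d3 > 0" "cball q d3 \<subseteq> U"
      by (meson open_contains_cball)
    \<comment> \<open>Halving makes \<open>d\<close> strictly smaller than all three radii. The
      summand 1 in the denominator of \<open>t\<close> covers the case that \<open>v\<close> and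
      \<open>w\<close> both vanish.\<close>
    define d where "d = Min {d1, d2, d3} / 2"
    define t where "t = d / (norm v + norm w + 1)"
    have d': "d > 0" "d < d1" "d < d2" "d < d3"
      using d d3 by (auto simp: d_def)
    have n: "norm v + norm w + 1 > 0"
      by (simp add: add_nonneg_pos)
    have t: "t > 0" using d' n by (simp add: t_def)
    have "t * (norm v + norm w) \<le> t * (norm v + norm w + 1)"
      using t by (simp add: algebra_simps)
    also have "\<dots> = d" using n by (simp add: t_def)
    finally have td: "t * (norm v + norm w) \<le> d" .
    then have sub: "cball q (t * (norm v + norm w)) \<subseteq> U" "cball q (t * (norm w + norm v)) \<subseteq> U"
      using d3 d' by (auto simp: add.commute)
    obtain \<xi> \<eta> where \<xi>: "dist \<xi> q \<le> t * (norm v + norm w)"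
      "f (q + t *\<^sub>R v + t *\<^sub>R w) - f (q + t *\<^sub>R v) - f (q + t *\<^sub>R w) + f q = t * t * g' \<xi> w"
      and \<eta>: "dist \<eta> q \<le> t * (norm w + norm v)"
      "f (q + t *\<^sub>R w + t *\<^sub>R v) - f (q + t *\<^sub>R w) - f (q + t *\<^sub>R v) + f q = t * t * h' \<eta> v"
      using diff_quot[OF t sub(1) g'] diff_quot[OF t sub(2) h'] by blast
    have "t * t * g' \<xi> w = t * t * h' \<eta> v"
      using \<xi>(2) \<eta>(2) by (simp add: algebra_simps)
    then have "g' \<xi> w = h' \<eta> v" using t by simp
    moreover have "\<bar>g' \<xi> w - g' q w\<bar> < e/2" "\<bar>h' \<eta> v - h' q v\<bar> < e/2"
      using d(2)[of \<xi>] d(4)[of \<eta>] \<xi>(1) \<eta>(1) td d' by (auto simp: add.commute)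
    ultimately show ?thesis by linarith
  qed
  then have "\<bar>g' q w - h' q v\<bar> \<le> 0"
    by (rule field_le_epsilon[of _ 0, simplified])
  then show ?thesis by simp
qed

text \<open>The mean value theorem is an equality only for real values, hence the passage to
  coordinates.\<close>

lemma second_derivative_symmetric:
  fixes f :: "'a::real_normed_vector \<Rightarrow> 'b::euclidean_space"
  assumes "open U" "q \<in> U"
    and f': "\<And>x. x \<in> U \<Longrightarrow> (f has_derivative f' x) (at x)"
    and g': "\<And>x. x \<in> U \<Longrightarrow> ((\<lambda>x. f' x v) has_derivative g' x) (at x)"
    and h': "\<And>x. x \<in> U \<Longrightarrow> ((\<lambda>x. f' x w) has_derivative h' x) (at x)"
    and g'c: "continuous_on U (\<lambda>x. g' x w)"
    and h'c: "continuous_on U (\<lambda>x. h' x v)"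
  shows "g' q w = h' q v"
proof (rule euclidean_eqI)
  fix b :: 'b assume "b \<in> Basis"
  show "g' q w \<bullet> b = h' q v \<bullet> b"
    by (rule schwarz_real[OF assms(1,2), of "\<lambda>x. f x \<bullet> b" "\<lambda>x v. f' x v \<bullet> b" v "\<lambda>x w. g' x w \<bullet> b" w "\<lambda>x w. h' x w \<bullet> b"])
      (auto intro!: has_derivative_inner_left f' g' h' continuous_intros g'c h'c)
qed

section \<open>Power series in several variables\<close>

definition monomial_at :: "'a::euclidean_space \<Rightarrow> ('a \<Rightarrow> nat) \<Rightarrow> real" where
  "monomial_at z \<alpha> = (\<Prod>b\<in>Basis. (z \<bullet> b) ^ \<alpha> b)"

definition multi_indices :: "('a::euclidean_space \<Rightarrow> nat) set" where
  "multi_indices = Basis \<rightarrow>\<^sub>E UNIV"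

definition power_series_on ::
    "('a::euclidean_space \<Rightarrow> 'b::euclidean_space) \<Rightarrow> (('a \<Rightarrow> nat) \<Rightarrow> 'b) \<Rightarrow> 'a \<Rightarrow> real \<Rightarrow> bool" where
  "power_series_on f c x r \<longleftrightarrow>
    (\<forall>y\<in>ball x r. ((\<lambda>\<alpha>. monomial_at (y - x) \<alpha> *\<^sub>R c \<alpha>) has_sum f y) multi_indices)"

lemma analytic_real_on_iff:
  "analytic_real_on f U \<longleftrightarrow>
    (\<forall>k. Ck_on k f U) \<and> (\<forall>x\<in>U. \<exists>c r. 0 < r \<and> power_series_on f c x r)"
  by (simp add: analytic_real_on_def power_series_on_def monomial_at_def multi_indices_def)

lemma power_series_on_mono: "power_series_on f c x r \<Longrightarrow> s \<le> r \<Longrightarrow> power_series_on f c x s"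
  unfolding power_series_on_def by auto

lemma summable_on_finite_sum:
  fixes g :: "'i \<Rightarrow> 'x \<Rightarrow> real"
  assumes "finite B" "\<And>b. b \<in> B \<Longrightarrow> g b summable_on X"
  shows "(\<lambda>x. \<Sum>b\<in>B. g b x) summable_on X"
  using assms by (induction B rule: finite_induct) (auto intro: summable_on_add)

text \<open>Unordered summability is absolute in finite dimension: it is so for each real
  coordinate, and the norm is at most the sum of the moduli of the coordinates.\<close>

lemma summable_on_imp_norm_summable_on:
  fixes f :: "'x \<Rightarrow> 'b::euclidean_space"
  assumes "f summable_on X"
  shows "(\<lambda>x. norm (f x)) summable_on X"
proof (rule Infinite_Sum.abs_summable_on_comparison_test')
  show "(\<lambda>x. \<Sum>b\<in>Basis. \<bar>f x \<bullet> b\<bar>) summable_on X"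
  proof (rule summable_on_finite_sum)
    fix b :: 'b
    have "(\<lambda>x. f x \<bullet> b) summable_on X"
      using summable_on_bounded_linear[OF bounded_linear_inner_left assms] .
    then show "(\<lambda>x. \<bar>f x \<bullet> b\<bar>) summable_on X"
      using summable_on_iff_abs_summable_on_real[of "\<lambda>x. f x \<bullet> b" X] by simp
  qed simp
qed (rule norm_le_l1)

text \<open>The iterated sums have the right value by linearity in each argument; the double family
  is absolutely summable, being dominated by a product of two summable families of norms, and this
  allows the passage from iterated to double sum.\<close>

lemma has_sum_bounded_bilinear:
  fixes u :: "'x \<Rightarrow> 'b::euclidean_space" and v :: "'y \<Rightarrow> 'c::euclidean_space"
    and h :: "'b \<Rightarrow> 'c \<Rightarrow> 'd::euclidean_space"
  assumes "bounded_bilinear h" "(u has_sum s) X" "(v has_sum t) Y"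
  shows "((\<lambda>(x, y). h (u x) (v y)) has_sum h s t) (X \<times> Y)"
proof (rule has_sum_SigmaI)
  interpret bounded_bilinear h by fact
  show "((\<lambda>y. case (x, y) of (x, y) \<Rightarrow> h (u x) (v y)) has_sum h (u x) t) Y" for x
    using has_sum_bounded_linear[OF bounded_linear_right assms(3)] by simp
  show "((\<lambda>x. h (u x) t) has_sum h s t) X"
    by (rule has_sum_bounded_linear[OF bounded_linear_left assms(2)])
  obtain K where K: "K > 0" "\<And>a b. norm (h a b) \<le> norm a * norm b * K"
    using pos_bounded by blast
  have u: "(\<lambda>x. norm (u x)) summable_on X" and v: "(\<lambda>y. norm (v y)) summable_on Y"
    using assms(2,3) by (auto intro: summable_on_imp_norm_summable_on has_sum_imp_summable)
  have "(\<lambda>(x, y). norm (u x) * norm (v y) * K) summable_on X \<times> Y"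
  proof (rule summable_on_SigmaI)
    show "((\<lambda>y. case (x, y) of (x, y) \<Rightarrow> norm (u x) * norm (v y) * K) has_sum
        norm (u x) * infsum (\<lambda>y. norm (v y)) Y * K) Y" for x
      using v by (auto intro!: has_sum_cmult_left has_sum_cmult_right has_sum_infsum)
    show "(\<lambda>x. norm (u x) * infsum (\<lambda>y. norm (v y)) Y * K) summable_on X"
      using u by (intro summable_on_cmult_left)
  qed (use K in auto)
  then have "(\<lambda>p. norm (case p of (x, y) \<Rightarrow> h (u x) (v y))) summable_on X \<times> Y"
    by (rule Infinite_Sum.abs_summable_on_comparison_test') (use K in auto)
  then show "(\<lambda>(x, y). h (u x) (v y)) summable_on X \<times> Y"
    by (rule abs_summable_summable)
qed

text \<open>\<open>restrict\<close> keeps the sum extensional, so that it is again an element of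
  \<open>multi_indices\<close>.\<close>

definition plus_index :: "('a::euclidean_space \<Rightarrow> nat) \<Rightarrow> ('a \<Rightarrow> nat) \<Rightarrow> 'a \<Rightarrow> nat" where
  "plus_index \<alpha> \<beta> = restrict (\<lambda>b. \<alpha> b + \<beta> b) Basis"

lemma plus_index_in: "plus_index \<alpha> \<beta> \<in> multi_indices"
  by (simp add: plus_index_def multi_indices_def)

lemma monomial_at_plus: "monomial_at z (plus_index \<alpha> \<beta>) = monomial_at z \<alpha> * monomial_at z \<beta>"
  by (simp add: monomial_at_def plus_index_def prod.distrib power_add)

text \<open>Both summands are bounded by \<gamma> in every coordinate. Hence each coefficient of the
  Cauchy product is a finite sum.\<close>

lemma finite_plus_index_fibre:
  "finite {(\<alpha>, \<beta>) \<in> multi_indices \<times> multi_indices. plus_index \<alpha> \<beta> = \<gamma>}"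
proof (rule finite_subset)
  let ?S = "\<Pi>\<^sub>E b\<in>Basis. {..\<gamma> b}"
  show "{(\<alpha>, \<beta>) \<in> multi_indices \<times> multi_indices. plus_index \<alpha> \<beta> = \<gamma>} \<subseteq> ?S \<times> ?S"
    by (auto simp: plus_index_def multi_indices_def PiE_iff extensional_def)
  show "finite (?S \<times> ?S)"
    by (intro finite_cartesian_product finite_PiE) auto
qed

text \<open>The Cauchy product: the double series of all products is regrouped by the total
  multi-index, which is legitimate since the summation is unordered.\<close>

lemma power_series_on_bounded_bilinear:
  fixes f :: "'a::euclidean_space \<Rightarrow> 'b::euclidean_space" and g :: "'a \<Rightarrow> 'c::euclidean_space"
    and h :: "'b \<Rightarrow> 'c \<Rightarrow> 'd::euclidean_space"
  assumes "bounded_bilinear h" "power_series_on f c x r" "power_series_on g d x r"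
  shows "power_series_on (\<lambda>y. h (f y) (g y))
    (\<lambda>\<gamma>. \<Sum>(\<alpha>, \<beta>) | (\<alpha>, \<beta>) \<in> multi_indices \<times> multi_indices \<and> plus_index \<alpha> \<beta> = \<gamma>. h (c \<alpha>) (d \<beta>)) x r"
  unfolding power_series_on_def
proof
  interpret bounded_bilinear h by fact
  fix y assume y: "y \<in> ball x r"
  define m where "m = monomial_at (y - x)"
  let ?I = "multi_indices :: ('a \<Rightarrow> nat) set"
  define F where "F \<gamma> = {(\<alpha>, \<beta>) \<in> ?I \<times> ?I. plus_index \<alpha> \<beta> = \<gamma>}" for \<gamma>
  let ?t = "\<lambda>(\<alpha>, \<beta>). h (m \<alpha> *\<^sub>R c \<alpha>) (m \<beta> *\<^sub>R d \<beta>)"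
  have *: "(?t has_sum h (f y) (g y)) (?I \<times> ?I)"
    using y assms(2,3) unfolding power_series_on_def m_def
    by (intro has_sum_bounded_bilinear[OF assms(1)]) auto
  \<comment> \<open>The disjoint union of the fibres of \<open>plus_index\<close> is the full
    product; the first component is determined by the second, and \<open>snd\<close> forgets
    it.\<close>
  have bij: "bij_betw snd (Sigma ?I F) (?I \<times> ?I)"
    by (rule bij_betwI[where g = "\<lambda>(\<alpha>, \<beta>). (plus_index \<alpha> \<beta>, (\<alpha>, \<beta>))"])
      (auto simp: F_def plus_index_in)
  have "((\<lambda>p. ?t (snd p)) has_sum h (f y) (g y)) (Sigma ?I F)"
    using * has_sum_reindex_bij_betw[OF bij, of ?t] by simp
  then have "((\<lambda>\<gamma>. \<Sum>p\<in>F \<gamma>. ?t p) has_sum h (f y) (g y)) ?I"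
  proof (rule has_sum_SigmaD)
    show "((\<lambda>p. ?t (snd (\<gamma>, p))) has_sum (\<Sum>p\<in>F \<gamma>. ?t p)) (F \<gamma>)" for \<gamma>
      using finite_plus_index_fibre[of \<gamma>] by (auto intro!: has_sum_finiteI simp: F_def)
  qed
  moreover have "(\<Sum>p\<in>F \<gamma>. ?t p) = m \<gamma> *\<^sub>R (\<Sum>(\<alpha>, \<beta>)\<in>F \<gamma>. h (c \<alpha>) (d \<beta>))" for \<gamma>
    unfolding scaleR_sum_right
    by (rule sum.cong) (auto simp: F_def m_def monomial_at_plus scaleR_left scaleR_right)
  ultimately show "((\<lambda>\<gamma>. monomial_at (y - x) \<gamma> *\<^sub>R
     (\<Sum>(\<alpha>, \<beta>) | (\<alpha>, \<beta>) \<in> ?I \<times> ?I \<and> plus_index \<alpha> \<beta> = \<gamma>. h (c \<alpha>) (d \<beta>))) has_sum h (f y) (g y)) ?I"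
    by (simp add: F_def m_def Collect_case_prod_Sigma split_def)
qed

text \<open>Multiplied by the remaining factors of a monomial, \<open>(\<sigma> + \<delta>) ^ n\<close> is a term of the series at a point whose
  \<open>b\<close>-coordinate has modulus \<open>\<sigma> + \<delta>\<close>; this dominates the termwise difference quotients in direction \<open>b\<close>.\<close>

lemma power_remainder_bounds:
  fixes s h \<sigma> \<delta> :: real
  assumes "\<bar>s\<bar> \<le> \<sigma>" "\<bar>h\<bar> \<le> \<delta>"
  shows "\<bar>(s + h) ^ n - s ^ n\<bar> * \<delta> \<le> \<bar>h\<bar> * (\<sigma> + \<delta>) ^ n" (is ?A)
    and "\<bar>(s + h) ^ n - s ^ n - h * (real n * s ^ (n - 1))\<bar> * \<delta>\<^sup>2 \<le> h\<^sup>2 * (\<sigma> + \<delta>) ^ n" (is ?B)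
    and "real n * \<bar>s\<bar> ^ (n - 1) * \<delta> \<le> (\<sigma> + \<delta>) ^ n" (is ?C)
proof -
  have pow: "\<bar>s + h\<bar> ^ n \<le> (\<sigma> + \<delta>) ^ n" "\<bar>s\<bar> ^ n \<le> (\<sigma> + \<delta>) ^ n" for n
    using assms by (intro power_mono; linarith)+
  have nn: "0 \<le> \<delta>" "0 \<le> \<sigma>" using assms by linarith+
  have A: "\<bar>(s + h) ^ n - s ^ n\<bar> * \<delta> \<le> \<bar>h\<bar> * (\<sigma> + \<delta>) ^ n" for n
  proof (induction n)
    case (Suc n)
    have "\<bar>(s + h) ^ Suc n - s ^ Suc n\<bar> * \<delta> = \<bar>s * ((s + h) ^ n - s ^ n) + h * (s + h) ^ n\<bar> * \<delta>"
      by (simp add: algebra_simps)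
    also have "\<dots> \<le> (\<bar>s\<bar> * \<bar>(s + h) ^ n - s ^ n\<bar> + \<bar>h\<bar> * \<bar>s + h\<bar> ^ n) * \<delta>"
      using nn by (intro mult_right_mono) (auto simp flip: abs_mult power_abs intro: order_trans[OF abs_triangle_ineq])
    also have "\<dots> = \<bar>s\<bar> * (\<bar>(s + h) ^ n - s ^ n\<bar> * \<delta>) + \<bar>h\<bar> * \<delta> * \<bar>s + h\<bar> ^ n"
      by (simp add: algebra_simps)
    also have "\<dots> \<le> \<sigma> * (\<bar>h\<bar> * (\<sigma> + \<delta>) ^ n) + \<bar>h\<bar> * \<delta> * (\<sigma> + \<delta>) ^ n"
      using nn by (intro add_mono mult_mono[OF assms(1) Suc.IH] mult_left_mono[OF pow(1)]) auto
    finally show ?case by (simp add: algebra_simps)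
  qed auto
  then show ?A .
  \<comment> \<open>The recursion that drives the second estimate. At \<open>n = 0\<close> the
    truncated exponent \<open>n - 1\<close> is harmless, because it comes with the factor
    \<open>real n = 0\<close>.\<close>
  have step: "(s + h) ^ Suc n - s ^ Suc n - h * (real (Suc n) * s ^ (Suc n - 1)) =
      s * ((s + h) ^ n - s ^ n - h * (real n * s ^ (n - 1))) + h * ((s + h) ^ n - s ^ n)" for n
    by (cases n) (simp_all add: algebra_simps)
  show ?B
  proof (induction n)
    case (Suc n)
    let ?e = "(s + h) ^ n - s ^ n - h * (real n * s ^ (n - 1))"
    have "\<bar>(s + h) ^ Suc n - s ^ Suc n - h * (real (Suc n) * s ^ (Suc n - 1))\<bar> * \<delta>\<^sup>2
      \<le> (\<bar>s\<bar> * \<bar>?e\<bar> + \<bar>h\<bar> * \<bar>(s + h) ^ n - s ^ n\<bar>) * \<delta>\<^sup>2"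
      unfolding step by (intro mult_right_mono) (auto simp flip: abs_mult)
    also have "\<dots> = \<bar>s\<bar> * (\<bar>?e\<bar> * \<delta>\<^sup>2) + \<bar>h\<bar> * \<delta> * (\<bar>(s + h) ^ n - s ^ n\<bar> * \<delta>)"
      by (simp add: algebra_simps power2_eq_square)
    also have "\<dots> \<le> \<sigma> * (h\<^sup>2 * (\<sigma> + \<delta>) ^ n) + \<bar>h\<bar> * \<delta> * (\<bar>h\<bar> * (\<sigma> + \<delta>) ^ n)"
      using nn by (intro add_mono mult_mono[OF assms(1) Suc.IH] mult_left_mono[OF A]) auto
    also have "\<dots> = h\<^sup>2 * (\<sigma> + \<delta>) ^ Suc n"
    proof -
      have "\<bar>h\<bar> * \<delta> * (\<bar>h\<bar> * (\<sigma> + \<delta>) ^ n) = \<bar>h\<bar>\<^sup>2 * \<delta> * (\<sigma> + \<delta>) ^ n"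
        by (simp only: power2_eq_square ac_simps)
      then show ?thesis by (simp add: algebra_simps)
    qed
    finally show ?case .
  qed auto
  show ?C
  proof (induction n)
    case (Suc n)
    have "real (Suc n) * \<bar>s\<bar> ^ (Suc n - 1) * \<delta> = \<bar>s\<bar> * (real n * \<bar>s\<bar> ^ (n - 1) * \<delta>) + \<bar>s\<bar> ^ n * \<delta>"
      by (cases n) (simp_all add: algebra_simps)
    also have "\<dots> \<le> \<sigma> * (\<sigma> + \<delta>) ^ n + (\<sigma> + \<delta>) ^ n * \<delta>"
      using nn by (intro add_mono mult_mono[OF assms(1) Suc.IH] mult_right_mono[OF pow(2)]) auto
    finally show ?case by (simp add: algebra_simps)
  qed auto
qed

text \<open>Dividing the bound by the modulus of \<open>s\<close> leaves a multiple of that modulus,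
  which tends to 0. This is the form in which a remainder estimated term by term becomes a
  derivative.\<close>

lemma has_vector_derivative_quadratic_remainder:
  fixes g :: "real \<Rightarrow> 'b::real_normed_vector"
  assumes "0 < \<delta>" "\<And>s. \<bar>s\<bar> \<le> \<delta> \<Longrightarrow> norm (g s - g 0 - s *\<^sub>R d) \<le> s\<^sup>2 * C"
  shows "(g has_vector_derivative d) (at 0)"
proof -
  have "((\<lambda>s. norm (g (0 + s) - g 0 - s *\<^sub>R d) / norm s) \<longlongrightarrow> 0) (at 0)"
  proof (rule Lim_null_comparison)
    show "\<forall>\<^sub>F s in at 0. norm (norm (g (0 + s) - g 0 - s *\<^sub>R d) / norm s) \<le> \<bar>s\<bar> * C"
      unfolding eventually_at
    proof (intro exI[of _ \<delta>] conjI ballI impI)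
      fix s :: real assume s: "s \<noteq> 0 \<and> dist s 0 < \<delta>"
      with assms(2)[of s] have "norm (g s - g 0 - s *\<^sub>R d) \<le> \<bar>s\<bar> * C * \<bar>s\<bar>"
        by (simp add: power2_eq_square algebra_simps)
      with s show "norm (norm (g (0 + s) - g 0 - s *\<^sub>R d) / norm s) \<le> \<bar>s\<bar> * C"
        by (simp add: divide_simps)
    qed fact
    show "((\<lambda>s::real. \<bar>s\<bar> * C) \<longlongrightarrow> 0) (at 0)"
      by (auto intro!: tendsto_eq_intros)
  qed
  then show ?thesis
    unfolding has_vector_derivative_def has_derivative_at
    by (simp add: bounded_linear_scaleR_left)
qed

text \<open>The derivative is known to exist, so only its value along \<open>b\<close> must be
  identified with the termwise derivative. On the line \<open>y + s b\<close> the sum of the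
  termwise second-order remainders is at most a constant times the square of \<open>s\<close>. The
  constant is finite because the dominating family \<open>B\<close> consists of the norms of the
  terms of the series at another point of the ball.\<close>

lemma power_series_on_derivative:
  fixes f :: "'a::euclidean_space \<Rightarrow> 'b::euclidean_space"
  assumes ps: "power_series_on f c x r" and b: "b \<in> Basis"
    and f': "\<And>y. y \<in> ball x r \<Longrightarrow> (f has_derivative f' y) (at y)"
  shows "power_series_on (\<lambda>y. f' y b) (\<lambda>\<beta>. real (Suc (\<beta> b)) *\<^sub>R c (\<beta>(b := Suc (\<beta> b)))) x r"
  unfolding power_series_on_def
proof
  fix y assume y: "y \<in> ball x r"
  let ?I = "multi_indices :: ('a \<Rightarrow> nat) set"
  define z where "z = y - x"
  \<comment> \<open>Half of the distance left to the boundary: shifts by at most \<delta> along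
    \<open>b\<close> stay inside the ball.\<close>
  define \<delta> where "\<delta> = (r - norm z) / 2"
  have z: "norm z < r" using y by (simp add: z_def dist_norm norm_minus_commute)
  have \<delta>: "0 < \<delta>" "norm z + \<delta> < r" using z by (simp_all add: \<delta>_def field_simps)
  define \<sigma> where "\<sigma> = \<bar>z \<bullet> b\<bar>"
  define M where "M \<alpha> = (\<Prod>b'\<in>Basis - {b}. (z \<bullet> b') ^ \<alpha> b')" for \<alpha> :: "'a \<Rightarrow> nat"
  have mono: "monomial_at (z + s *\<^sub>R b) \<alpha> = (z \<bullet> b + s) ^ \<alpha> b * M \<alpha>" for s \<alpha>
  proof -
    have "monomial_at (z + s *\<^sub>R b) \<alpha> = ((z + s *\<^sub>R b) \<bullet> b) ^ \<alpha> b *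
        (\<Prod>b'\<in>Basis - {b}. ((z + s *\<^sub>R b) \<bullet> b') ^ \<alpha> b')"
      unfolding monomial_at_def using b by (simp add: prod.remove)
    also have "(\<Prod>b'\<in>Basis - {b}. ((z + s *\<^sub>R b) \<bullet> b') ^ \<alpha> b') = M \<alpha>"
      unfolding M_def using b by (intro prod.cong) (auto simp: inner_add_left inner_Basis)
    finally show ?thesis using b by (simp add: inner_add_left)
  qed
  have sum: "((\<lambda>\<alpha>. ((z \<bullet> b + s) ^ \<alpha> b * M \<alpha>) *\<^sub>R c \<alpha>) has_sum f (y + s *\<^sub>R b)) ?I" if "\<bar>s\<bar> \<le> \<delta>" for s
  proof -
    have "norm (z + s *\<^sub>R b) \<le> norm z + \<bar>s\<bar>"
      using norm_triangle_ineq[of z "s *\<^sub>R b"] b by simp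
    with that \<delta> have "norm (z + s *\<^sub>R b) < r" by linarith
    then have "y + s *\<^sub>R b \<in> ball x r"
      by (simp add: z_def dist_norm norm_minus_commute algebra_simps)
    then have "((\<lambda>\<alpha>. monomial_at (y + s *\<^sub>R b - x) \<alpha> *\<^sub>R c \<alpha>) has_sum f (y + s *\<^sub>R b)) ?I"
      using ps by (auto simp: power_series_on_def)
    moreover have "y + s *\<^sub>R b - x = z + s *\<^sub>R b" by (simp add: z_def)
    ultimately show ?thesis by (simp add: mono)
  qed
  define B where "B \<alpha> = (\<sigma> + \<delta>) ^ \<alpha> b * (\<bar>M \<alpha>\<bar> * norm (c \<alpha>))" for \<alpha>
  have B: "B summable_on ?I"
  proof -
    \<comment> \<open>The sign is chosen so that the shift moves the \<open>b\<close>-coordinate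
      away from 0; its modulus becomes exactly \<open>\<sigma> + \<delta>\<close>.\<close>
    define s where "s = (if z \<bullet> b \<ge> 0 then \<delta> else - \<delta>)"
    have "\<bar>z \<bullet> b + s\<bar> = \<sigma> + \<delta>" "\<bar>s\<bar> \<le> \<delta>"
      using \<delta> by (auto simp: s_def \<sigma>_def)
    with summable_on_imp_norm_summable_on[OF has_sum_imp_summable[OF sum[of s]]]
    show ?thesis
      unfolding B_def by (simp add: abs_mult power_abs mult.assoc)
  qed
  \<comment> \<open>The termwise derivative, still indexed by the multi-indices of \<open>f\<close>.
    Where \<alpha> vanishes at \<open>b\<close> the factor \<open>real (\<alpha> b)\<close> makes
    the term 0, whatever the truncated exponent.\<close>
  define D where "D \<alpha> = (real (\<alpha> b) * (z \<bullet> b) ^ (\<alpha> b - 1) * M \<alpha>) *\<^sub>R c \<alpha>" for \<alpha>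
  have normD: "norm (D \<alpha>) \<le> B \<alpha> / \<delta>" for \<alpha>
  proof -
    have "norm (D \<alpha>) * \<delta> = (real (\<alpha> b) * \<bar>z \<bullet> b\<bar> ^ (\<alpha> b - 1) * \<delta>) * (\<bar>M \<alpha>\<bar> * norm (c \<alpha>))"
      by (simp add: D_def abs_mult power_abs)
    also have "\<dots> \<le> B \<alpha>"
      unfolding B_def using power_remainder_bounds(3)[of "z \<bullet> b" \<sigma> 0 \<delta> "\<alpha> b"] \<delta>
      by (intro mult_right_mono) (auto simp: \<sigma>_def)
    finally show ?thesis using \<delta> by (simp add: field_simps)
  qed
  have "(\<lambda>\<alpha>. B \<alpha> / \<delta>) summable_on ?I"
    using summable_on_cmult_left[OF B, of "1 / \<delta>"] by simp
  then have "(\<lambda>\<alpha>. norm (D \<alpha>)) summable_on ?I"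
    by (rule Infinite_Sum.abs_summable_on_comparison_test') (rule normD)
  then have "D summable_on ?I"
    by (rule abs_summable_summable)
  then have D: "(D has_sum infsum D ?I) ?I" by simp
  have "((\<lambda>s. f (y + s *\<^sub>R b)) has_vector_derivative infsum D ?I) (at 0)"
  proof (rule has_vector_derivative_quadratic_remainder)
    fix s assume s: "\<bar>s\<bar> \<le> \<delta>"
    let ?e = "\<lambda>\<alpha>. (z \<bullet> b + s) ^ \<alpha> b - (z \<bullet> b) ^ \<alpha> b - s * (real (\<alpha> b) * (z \<bullet> b) ^ (\<alpha> b - 1))"
    let ?t = "\<lambda>\<alpha>. (?e \<alpha> * M \<alpha>) *\<^sub>R c \<alpha>"
    have "((\<lambda>\<alpha>. ((z \<bullet> b + s) ^ \<alpha> b * M \<alpha>) *\<^sub>R c \<alpha> + - (((z \<bullet> b + 0) ^ \<alpha> b * M \<alpha>) *\<^sub>R c \<alpha>) + (- s) *\<^sub>R D \<alpha>)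
       has_sum (f (y + s *\<^sub>R b) + - f (y + 0 *\<^sub>R b) + (- s) *\<^sub>R infsum D ?I)) ?I"
      using \<delta> sum[of 0] by (intro has_sum_add sum s has_sum_scaleR D) (auto simp: has_sum_uminus)
    moreover have "((z \<bullet> b + s) ^ \<alpha> b * M \<alpha>) *\<^sub>R c \<alpha> + - (((z \<bullet> b + 0) ^ \<alpha> b * M \<alpha>) *\<^sub>R c \<alpha>) + (- s) *\<^sub>R D \<alpha> = ?t \<alpha>" for \<alpha>
      by (simp add: D_def algebra_simps)
    ultimately have t: "(?t has_sum (f (y + s *\<^sub>R b) - f (y + 0 *\<^sub>R b) - s *\<^sub>R infsum D ?I)) ?I"
      by simp
    have bound: "norm (?t \<alpha>) \<le> s\<^sup>2 / \<delta>\<^sup>2 * B \<alpha>" for \<alpha>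
    proof -
      have "norm (?t \<alpha>) * \<delta>\<^sup>2 = (\<bar>?e \<alpha>\<bar> * \<delta>\<^sup>2) * (\<bar>M \<alpha>\<bar> * norm (c \<alpha>))"
        by (simp add: abs_mult)
      also have "\<dots> \<le> (s\<^sup>2 * (\<sigma> + \<delta>) ^ \<alpha> b) * (\<bar>M \<alpha>\<bar> * norm (c \<alpha>))"
        using s by (intro mult_right_mono power_remainder_bounds(2)) (auto simp: \<sigma>_def)
      finally show ?thesis
        using \<delta> by (simp add: B_def field_simps)
    qed
    have "norm (f (y + s *\<^sub>R b) - f (y + 0 *\<^sub>R b) - s *\<^sub>R infsum D ?I) \<le> infsum (\<lambda>\<alpha>. norm (?t \<alpha>)) ?I"
      using norm_has_sum_bound[OF has_sum_infsum[OF summable_on_imp_norm_summable_on[OF has_sum_imp_summable[OF t]]] t] .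
    also have "\<dots> \<le> infsum (\<lambda>\<alpha>. s\<^sup>2 / \<delta>\<^sup>2 * B \<alpha>) ?I"
      by (intro infsum_mono bound summable_on_cmult_right B
          summable_on_imp_norm_summable_on has_sum_imp_summable[OF t])
    also have "\<dots> = s\<^sup>2 * (infsum B ?I / \<delta>\<^sup>2)"
      by (subst infsum_cmult_right') simp
    finally show "norm (f (y + s *\<^sub>R b) - f (y + 0 *\<^sub>R b) - s *\<^sub>R infsum D ?I) \<le> s\<^sup>2 * (infsum B ?I / \<delta>\<^sup>2)" .
  qed (use \<delta> in simp)
  moreover have "((\<lambda>s. f (y + s *\<^sub>R b)) has_vector_derivative f' y b) (at 0)"
    unfolding has_vector_derivative_def
  proof -
    have "((\<lambda>s. y + s *\<^sub>R b) has_derivative (\<lambda>s. s *\<^sub>R b)) (at 0)"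
      by (auto intro!: derivative_eq_intros)
    moreover have "(f has_derivative f' y) (at (y + 0 *\<^sub>R b))"
      using f'[OF y] by simp
    ultimately have "((\<lambda>s. f (y + s *\<^sub>R b)) has_derivative (\<lambda>s. f' y (s *\<^sub>R b))) (at 0)"
      by (rule has_derivative_compose)
    then show "((\<lambda>s. f (y + s *\<^sub>R b)) has_derivative (\<lambda>s. s *\<^sub>R f' y b)) (at 0)"
      using has_derivative_linear[OF f'[OF y]] by (simp add: linear_cmul)
  qed
  ultimately have "infsum D ?I = f' y b"
    by (rule vector_derivative_unique_at)
  with D have "(D has_sum f' y b) ?I" by simp
  \<comment> \<open>The vanishing terms are discarded because the shift raising the
    \<open>b\<close>-entry by one reaches exactly the remaining indices; summing over its source
    gives the coefficients of the derivative.\<close>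
  then have *: "(D has_sum f' y b) {\<alpha> \<in> ?I. \<alpha> b \<noteq> 0}"
    by (subst has_sum_cong_neutral[where T = ?I and g = D]) (auto simp: D_def)
  have bij: "bij_betw (\<lambda>\<beta>. \<beta>(b := Suc (\<beta> b))) ?I {\<alpha> \<in> ?I. \<alpha> b \<noteq> 0}"
    using b by (intro bij_betwI[where g = "\<lambda>\<alpha>. \<alpha>(b := \<alpha> b - 1)"])
      (auto simp: multi_indices_def PiE_iff extensional_def)
  have "((\<lambda>\<beta>. D (\<beta>(b := Suc (\<beta> b)))) has_sum f' y b) ?I"
    using * has_sum_reindex_bij_betw[OF bij, of D] by simp
  moreover have "D (\<beta>(b := Suc (\<beta> b))) =
      monomial_at (y - x) \<beta> *\<^sub>R (real (Suc (\<beta> b)) *\<^sub>R c (\<beta>(b := Suc (\<beta> b))))" for \<beta>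
  proof -
    have "M (\<beta>(b := Suc (\<beta> b))) = M \<beta>"
      unfolding M_def by (intro prod.cong) auto
    moreover have "monomial_at (y - x) \<beta> = (z \<bullet> b) ^ \<beta> b * M \<beta>"
      using mono[of 0 \<beta>] by (simp add: z_def)
    ultimately show ?thesis by (simp add: D_def algebra_simps)
  qed
  ultimately show "((\<lambda>\<beta>. monomial_at (y - x) \<beta> *\<^sub>R (real (Suc (\<beta> b)) *\<^sub>R c (\<beta>(b := Suc (\<beta> b)))))
      has_sum f' y b) ?I"
    by simp
qed

section \<open>Operations on real analytic functions\<close>

lemma analytic_real_on_bounded_linear:
  assumes "bounded_linear h" "analytic_real_on f U"
  shows "analytic_real_on (\<lambda>x. h (f x)) U"
  unfolding analytic_real_on_iff
proof (intro conjI allI ballI)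
  show "Ck_on k (\<lambda>x. h (f x)) U" for k
    using assms by (auto simp: analytic_real_on_iff intro: Ck_on_bounded_linear)
  fix x assume "x \<in> U"
  with assms(2) obtain c r where cr: "0 < r" "power_series_on f c x r"
    unfolding analytic_real_on_iff by blast
  have "power_series_on (\<lambda>x. h (f x)) (\<lambda>\<alpha>. h (c \<alpha>)) x r"
    using cr(2) has_sum_bounded_linear[OF assms(1)] linear_cmul[OF bounded_linear.linear[OF assms(1)]]
    unfolding power_series_on_def by fastforce
  with cr(1) show "\<exists>c r. 0 < r \<and> power_series_on (\<lambda>x. h (f x)) c x r"
    by blast
qed

lemma analytic_real_on_common_ball:
  assumes "analytic_real_on f U" "analytic_real_on g U" "x \<in> U"
  obtains c d r where "0 < r" "power_series_on f c x r" "power_series_on g d x r"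
proof -
  from assms obtain c r d s where *: "0 < r" "power_series_on f c x r" "0 < s" "power_series_on g d x s"
    unfolding analytic_real_on_iff by blast
  show thesis
    by (rule that[of "min r s" c d]) (use * in \<open>auto intro: power_series_on_mono\<close>)
qed

lemma analytic_real_on_add:
  assumes "analytic_real_on f U" "analytic_real_on g U"
  shows "analytic_real_on (\<lambda>x. f x + g x) U"
  unfolding analytic_real_on_iff
proof (intro conjI allI ballI)
  show "Ck_on k (\<lambda>x. f x + g x) U" for k
    using assms by (auto simp: analytic_real_on_iff intro: Ck_on_add)
  fix x assume "x \<in> U"
  with assms obtain c d r where cr: "0 < r" "power_series_on f c x r" "power_series_on g d x r"
    by (rule analytic_real_on_common_ball)
  have "power_series_on (\<lambda>x. f x + g x) (\<lambda>\<alpha>. c \<alpha> + d \<alpha>) x r"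
    using cr(2,3) unfolding power_series_on_def by (auto simp: scaleR_add_right intro: has_sum_add)
  with cr(1) show "\<exists>c r. 0 < r \<and> power_series_on (\<lambda>x. f x + g x) c x r"
    by blast
qed

lemma analytic_real_on_bounded_bilinear:
  assumes "bounded_bilinear h" "analytic_real_on f U" "analytic_real_on g U"
  shows "analytic_real_on (\<lambda>x. h (f x) (g x)) U"
  unfolding analytic_real_on_iff
proof (intro conjI allI ballI)
  show "Ck_on k (\<lambda>x. h (f x) (g x)) U" for k
    using assms by (auto simp: analytic_real_on_iff intro: Ck_on_bounded_bilinear)
  fix x assume "x \<in> U"
  with assms(2,3) obtain c d r where cr: "0 < r" "power_series_on f c x r" "power_series_on g d x r"
    by (rule analytic_real_on_common_ball)
  with power_series_on_bounded_bilinear[OF assms(1) cr(2,3)]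
  show "\<exists>c r. 0 < r \<and> power_series_on (\<lambda>x. h (f x) (g x)) c x r"
    by blast
qed

lemma analytic_real_on_cong:
  assumes "open U" "\<And>x. x \<in> U \<Longrightarrow> f x = g x" "analytic_real_on f U"
  shows "analytic_real_on g U"
  unfolding analytic_real_on_iff
proof (intro conjI allI ballI)
  show "Ck_on k g U" for k
    using assms by (auto simp: analytic_real_on_iff intro: Ck_on_cong[of U f])
  fix x assume x: "x \<in> U"
  with assms(3) obtain c r where cr: "0 < r" "power_series_on f c x r"
    unfolding analytic_real_on_iff by blast
  from x assms(1) obtain s where s: "0 < s" "ball x s \<subseteq> U"
    by (meson open_contains_ball)
  have "power_series_on g c x (min r s)"
    using cr(2) s(2) assms(2) unfolding power_series_on_def by (auto simp: subset_iff) force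
  with cr(1) s(1) show "\<exists>c r. 0 < r \<and> power_series_on g c x r"
    by (intro exI[of _ c] exI[of _ "min r s"]) auto
qed

text \<open>The derivative inside \<open>Ck_on\<close> is existentially quantified; uniqueness of
  derivatives exchanges it for the prescribed one.\<close>

lemma Ck_on_partial_derivative:
  assumes "open U" "Ck_on (Suc k) f U" "\<And>x. x \<in> U \<Longrightarrow> (f has_derivative f' x) (at x)"
  shows "Ck_on k (\<lambda>x. f' x v) U"
proof -
  from assms(2) obtain f'' where f'': "\<forall>x\<in>U. (f has_derivative f'' x) (at x)" "\<forall>v. Ck_on k (\<lambda>x. f'' x v) U"
    by auto
  then have "f'' x = f' x" if "x \<in> U" for x
    using that assms(3) has_derivative_unique by blast
  with f'' show ?thesis
    by (auto intro: Ck_on_cong[OF assms(1), of "\<lambda>x. f'' x v"])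
qed

lemma analytic_real_on_partial_derivative:
  assumes "open U" "analytic_real_on f U" "\<And>x. x \<in> U \<Longrightarrow> (f has_derivative f' x) (at x)" "b \<in> Basis"
  shows "analytic_real_on (\<lambda>x. f' x b) U"
  unfolding analytic_real_on_iff
proof (intro conjI allI ballI)
  show "Ck_on k (\<lambda>x. f' x b) U" for k
    by (rule Ck_on_partial_derivative[OF assms(1) _ assms(3)])
      (use assms(2) in \<open>auto simp: analytic_real_on_iff simp del: Ck_on.simps\<close>)
  fix x assume x: "x \<in> U"
  with assms(2) obtain c r where cr: "0 < r" "power_series_on f c x r"
    unfolding analytic_real_on_iff by blast
  from x assms(1) obtain s where s: "0 < s" "ball x s \<subseteq> U"
    by (meson open_contains_ball)
  have "power_series_on f c x (min r s)"
    using cr(2) by (rule power_series_on_mono) simp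
  then have "power_series_on (\<lambda>y. f' y b) (\<lambda>\<beta>. real (Suc (\<beta> b)) *\<^sub>R c (\<beta>(b := Suc (\<beta> b)))) x (min r s)"
    by (rule power_series_on_derivative[OF _ assms(4)]) (use assms(3) s in \<open>auto simp: subset_iff\<close>)
  with cr(1) s(1) show "\<exists>c r. 0 < r \<and> power_series_on (\<lambda>x. f' x b) c x r"
    by (meson min_less_iff_conj)
qed

section \<open>Operations common to all smoothness classes\<close>

lemma of_class_bounded_linear:
  "bounded_linear h \<Longrightarrow> of_class \<kappa> f U \<Longrightarrow> of_class \<kappa> (\<lambda>x. h (f x)) U"
  by (cases \<kappa>) (auto intro: Ck_on_bounded_linear analytic_real_on_bounded_linear)

lemma of_class_add:
  "of_class \<kappa> f U \<Longrightarrow> of_class \<kappa> g U \<Longrightarrow> of_class \<kappa> (\<lambda>x. f x + g x) U"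
  by (cases \<kappa>) (auto intro: Ck_on_add analytic_real_on_add)

lemma of_class_bounded_bilinear:
  "bounded_bilinear h \<Longrightarrow> of_class \<kappa> f U \<Longrightarrow> of_class \<kappa> g U \<Longrightarrow> of_class \<kappa> (\<lambda>x. h (f x) (g x)) U"
  by (cases \<kappa>) (auto intro: Ck_on_bounded_bilinear analytic_real_on_bounded_bilinear)

lemma of_class_cong:
  "open U \<Longrightarrow> (\<And>x. x \<in> U \<Longrightarrow> f x = g x) \<Longrightarrow> of_class \<kappa> f U \<Longrightarrow> of_class \<kappa> g U"
  by (cases \<kappa>) (auto intro: Ck_on_cong[of U f g] analytic_real_on_cong[of U f g])

lemma of_class_subset:
  "of_class \<kappa> f U \<Longrightarrow> V \<subseteq> U \<Longrightarrow> of_class \<kappa> f V"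
  by (cases \<kappa>) (auto simp: analytic_real_on_iff intro: Ck_on_subset)

lemma of_class_imp_Ck_on: "of_class \<kappa> f U \<Longrightarrow> at_least_C k \<kappa> \<Longrightarrow> Ck_on k f U"
  by (cases \<kappa>) (auto simp: analytic_real_on_iff intro: Ck_on_antimono)

lemma of_class_lose_derivs:
  "of_class \<kappa> f U \<Longrightarrow> of_class (lose_derivs j \<kappa>) f U"
  by (cases \<kappa>) (auto intro: Ck_on_antimono)

text \<open>The auxiliary \<open>f\<close> handles the empty sum uniformly in \<kappa>: the zero
  function is its image under the zero map.\<close>

lemma of_class_sum:
  assumes "finite B" "of_class \<kappa> f U" "\<And>b. b \<in> B \<Longrightarrow> of_class \<kappa> (g b) U"
  shows "of_class \<kappa> (\<lambda>x. \<Sum>b\<in>B. g b x) U"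
  using assms(1,3)
proof (induction B rule: finite_induct)
  case empty
  show ?case
    using of_class_bounded_linear[OF bounded_linear_zero assms(2)] by simp
qed (auto intro: of_class_add)

lemma of_class_Pair:
  assumes "of_class \<kappa> f U" "of_class \<kappa> g U"
  shows "of_class \<kappa> (\<lambda>x. (f x, g x)) U"
proof -
  have "bounded_linear (\<lambda>x. (x, 0))" "bounded_linear (\<lambda>x. (0, x))"
    by (auto intro!: bounded_linear_Pair bounded_linear_ident bounded_linear_zero)
  from of_class_add[OF of_class_bounded_linear[OF this(1) assms(1)] of_class_bounded_linear[OF this(2) assms(2)]]
  show ?thesis by simp
qed

lemma of_class_diff:
  assumes "of_class \<kappa> f U" "of_class \<kappa> g U"
  shows "of_class \<kappa> (\<lambda>x. f x - g x) U"
  using of_class_add[OF assms(1) of_class_bounded_linear[OF bounded_linear_minus[OF bounded_linear_ident] assms(2)]]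
  by simp

lemma of_class_differentiable:
  assumes "of_class \<kappa> f U" "at_least_C 1 \<kappa>" "x \<in> U"
  shows "(f has_derivative frechet_derivative f (at x)) (at x)"
  using of_class_imp_Ck_on[OF assms(1,2)] assms(3) frechet_derivative_works
  by (auto simp: differentiable_def)

text \<open>By linearity the derivative along \<open>g\<close> is a finite sum of coordinates of
  \<open>g\<close> times partial derivatives of \<open>f\<close>, so closure under sums, products
  and partial derivatives suffices.\<close>

lemma of_class_directional_derivative:
  assumes "open U" "of_class \<kappa> f U" "at_least_C 1 \<kappa>" "of_class (lose_derivs 1 \<kappa>) g U"
  shows "of_class (lose_derivs 1 \<kappa>) (\<lambda>x. frechet_derivative f (at x) (g x)) U"
proof -
  let ?D = "\<lambda>x. frechet_derivative f (at x)"
  note D = of_class_differentiable[OF assms(2,3)]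
  have "of_class (lose_derivs 1 \<kappa>) (\<lambda>x. ?D x b) U" if "b \<in> Basis" for b
  proof (cases \<kappa>)
    case (C_fin k)
    \<comment> \<open>\<open>at_least_C 1\<close> excludes \<open>k = 0\<close>, where the truncated
      \<open>k - 1\<close> would not lose a derivative.\<close>
    with assms(3) obtain j where "k = Suc j" by (cases k) auto
    with assms C_fin D Ck_on_partial_derivative[of U j f ?D b] show ?thesis by (simp del: Ck_on.simps)
  next
    case C_infinity
    then have "Ck_on (Suc j) f U" for j
      using assms(2) by (simp del: Ck_on.simps)
    with C_infinity assms D Ck_on_partial_derivative[of U _ f ?D b] show ?thesis by (simp del: Ck_on.simps)
  next
    case C_omega
    with assms D that analytic_real_on_partial_derivative[of U f ?D b] show ?thesis by simp
  qed
  then have "of_class (lose_derivs 1 \<kappa>) (\<lambda>x. \<Sum>b\<in>Basis. (g x \<bullet> b) *\<^sub>R ?D x b) U"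
    by (intro of_class_sum[OF finite_Basis assms(4)] of_class_bounded_bilinear[OF bounded_bilinear_scaleR]
        of_class_bounded_linear[OF bounded_linear_inner_left assms(4)])
  moreover have "(\<Sum>b\<in>Basis. (g x \<bullet> b) *\<^sub>R ?D x b) = ?D x (g x)" if "x \<in> U" for x
  proof -
    have "linear (?D x)" using D[OF that] has_derivative_linear by blast
    then have "?D x (\<Sum>b\<in>Basis. (g x \<bullet> b) *\<^sub>R b) = (\<Sum>b\<in>Basis. (g x \<bullet> b) *\<^sub>R ?D x b)"
      by (simp add: linear_sum linear_cmul)
    then show ?thesis by (simp add: euclidean_representation)
  qed
  ultimately show ?thesis
    by (rule of_class_cong[OF assms(1), rotated])
qed

section \<open>Tangent spaces and brackets\<close>

text \<open>The inner product of \<open>g\<close> with the component \<open>z\<close> of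
  \<open>w\<close> orthogonal to \<open>E\<close> is 0 near 0, hence so is that of \<open>w\<close>
  with \<open>z\<close>, which equals the squared norm of \<open>z\<close>.\<close>

lemma vector_derivative_in_subspace:
  fixes g :: "real \<Rightarrow> 'a::euclidean_space"
  assumes "(g has_vector_derivative w) (at 0)" "0 < \<delta>" "\<And>t. \<bar>t\<bar> < \<delta> \<Longrightarrow> g t \<in> E" "subspace E"
  shows "w \<in> E"
proof -
  obtain y z where yz: "y \<in> span E" "\<And>e. e \<in> span E \<Longrightarrow> orthogonal z e" "w = y + z"
    using orthogonal_subspace_decomp_exists[of E w] by blast
  have span: "span E = E" using assms(4) by (simp add: span_eq_iff)
  have "((\<lambda>t. g t \<bullet> z) has_vector_derivative w \<bullet> z) (at 0)"
    using bounded_linear.has_vector_derivative[OF bounded_linear_inner_left assms(1)] .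
  then have "((\<lambda>t. 0) has_vector_derivative w \<bullet> z) (at 0)"
  proof (rule has_vector_derivative_transform_within_open)
    show "g t \<bullet> z = 0" if "t \<in> {- \<delta><..<\<delta>}" for t
      using yz(2)[of "g t"] assms(3)[of t] that span by (auto simp: orthogonal_def inner_commute)
  qed (use assms(2) in auto)
  then have "w \<bullet> z = 0"
    using has_vector_derivative_const vector_derivative_unique_at by blast
  moreover have "y \<bullet> z = 0"
    using yz by (simp add: orthogonal_def inner_commute)
  ultimately have "z = 0"
    using yz(3) by (simp add: inner_add_left)
  with yz span show ?thesis by simp
qed

text \<open>Composing \<open>F\<close> with a curve that realizes \<open>v\<close> reduces the claim
  to a curve in \<open>E\<close>. Since the curve runs in \<open>S\<close>, a derivative within
  \<open>S\<close> is enough for the chain rule.\<close>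

lemma derivative_along_tangent_in_subspace:
  fixes F :: "'a::euclidean_space \<Rightarrow> 'b::euclidean_space"
  assumes v: "v \<in> tangent_space S q" and F: "(F has_derivative F') (at q within S)"
    and "open U" "q \<in> U" "\<And>x. x \<in> S \<inter> U \<Longrightarrow> F x \<in> E" "subspace E"
  shows "F' v \<in> E"
proof -
  from v obtain \<gamma> \<epsilon> where \<gamma>: "0 < \<epsilon>" "\<gamma> ` {-\<epsilon><..<\<epsilon>} \<subseteq> S" "\<gamma> 0 = q" "(\<gamma> has_vector_derivative v) (at 0)"
    unfolding tangent_space_def by blast
  have "isCont \<gamma> 0"
    using \<gamma>(4) has_vector_derivative_continuous by blast
  then have "\<forall>\<^sub>F t in at 0. \<gamma> t \<in> U"
    using assms(3,4) \<gamma>(3) unfolding isCont_def by (auto intro: topological_tendstoD)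
  then obtain \<delta> where \<delta>: "0 < \<delta>" "\<And>t. t \<noteq> 0 \<Longrightarrow> \<bar>t\<bar> < \<delta> \<Longrightarrow> \<gamma> t \<in> U"
    unfolding eventually_at by auto
  then have \<delta>U: "\<gamma> t \<in> U" if "\<bar>t\<bar> < \<delta>" for t
    using that assms(4) \<gamma>(3) by (cases "t = 0") auto
  have "(\<gamma> has_vector_derivative v) (at 0 within {-\<epsilon><..<\<epsilon>})"
    using \<gamma>(4) has_vector_derivative_at_within by blast
  then have "((F \<circ> \<gamma>) has_vector_derivative F' v) (at 0 within {-\<epsilon><..<\<epsilon>})"
    by (rule vector_derivative_diff_chain_within[OF _ has_derivative_subset[OF F \<gamma>(2), folded \<gamma>(3)]])
  then have "((F \<circ> \<gamma>) has_vector_derivative F' v) (at 0)"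
    using \<gamma>(1) has_vector_derivative_within_open[of 0 "{-\<epsilon><..<\<epsilon>}" "F \<circ> \<gamma>"] by auto
  then show ?thesis
    by (rule vector_derivative_in_subspace[of _ _ "min \<delta> \<epsilon>"]) (use \<delta>(1) \<delta>U \<gamma> assms(5,6) in \<open>auto simp: image_subset_iff abs_less_iff\<close>)
qed

text \<open>The function \<open>F - F\<close> takes values in \<open>{0}\<close> and has the
  derivative \<open>F1 - F2\<close> within \<open>S\<close>. This makes the choice hidden in
  \<open>frechet_derivative\<close> harmless on tangent vectors.\<close>

lemma derivative_within_unique_on_tangent:
  fixes F :: "'a::euclidean_space \<Rightarrow> 'b::euclidean_space"
  assumes "v \<in> tangent_space S q" "(F has_derivative F1) (at q within S)" "(F has_derivative F2) (at q within S)"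
  shows "F1 v = F2 v"
  using derivative_along_tangent_in_subspace[OF assms(1) has_derivative_diff[OF assms(2,3)] open_UNIV, of "{0}"]
  by simp

lemma lie_bracket_eq:
  fixes X Y :: "'a::euclidean_space \<Rightarrow> 'a"
  assumes "X q \<in> tangent_space S q" "Y q \<in> tangent_space S q" "q \<in> S" "open U" "q \<in> U"
    and "\<And>x. x \<in> S \<inter> U \<Longrightarrow> X' x = X x" "\<And>x. x \<in> S \<inter> U \<Longrightarrow> Y' x = Y x"
    and "(X' has_derivative DX) (at q)" "(Y' has_derivative DY) (at q)"
  shows "lie_bracket S X Y q = DY (X q) - DX (Y q)"
proof -
  obtain d where d: "0 < d" "ball q d \<subseteq> U" using assms(4,5) by (meson open_contains_ball)
  have within: "(Z has_derivative D) (at q within S)"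
    if "\<And>x. x \<in> S \<inter> U \<Longrightarrow> Z' x = Z x" "(Z' has_derivative D) (at q)" for Z Z' :: "'a \<Rightarrow> 'a" and D
    by (rule has_derivative_transform_within[OF has_derivative_at_withinI[OF that(2)] d(1) assms(3)])
      (use that(1) d(2) in \<open>auto simp: subset_iff dist_commute\<close>)
  have eq: "frechet_derivative Z (at q within S) v = D v"
    if "v \<in> tangent_space S q" "(Z has_derivative D) (at q within S)" for Z :: "'a \<Rightarrow> 'a" and D v
    using differentiableI[OF that(2)] unfolding frechet_derivative_works
    by (intro derivative_within_unique_on_tangent[OF that(1) _ that(2)])
  show ?thesis
    unfolding lie_bracket_def
    using eq[OF assms(1) within[OF assms(7,9)]] eq[OF assms(2) within[OF assms(6,8)]] by simp
qed

text \<open>For a vector with \<open>D v\<close> in \<open>E\<close>, the straight line through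
  \<open>\<phi> q\<close> in direction \<open>D v\<close> stays in \<open>E\<close>, and \<psi>
  pulls it back to a C1 curve in \<open>S\<close> with velocity \<open>v\<close>. The dimension
  follows because differentiating the two inversion identities makes \<open>D\<close> an
  isomorphism, which carries the tangent space onto \<open>E\<close>.\<close>

lemma tangent_space_slice_chart:
  fixes S :: "'a::euclidean_space set"
  assumes "open U" "open W" "homeomorphism U W \<phi> \<psi>" "Ck_on 1 \<psi> W" "subspace E" "\<phi> ` (S \<inter> U) = E \<inter> W"
    and q: "q \<in> S" "q \<in> U" and D: "(\<phi> has_derivative D) (at q)"
  shows "tangent_space S q = {v. D v \<in> E}" and "dim (tangent_space S q) = dim E"
proof -
  have \<phi>q: "\<phi> q \<in> E" "\<phi> q \<in> W"
    using assms(6) q by blast+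
  have inv: "\<And>x. x \<in> U \<Longrightarrow> \<psi> (\<phi> x) = x" "\<And>x. x \<in> W \<Longrightarrow> \<phi> (\<psi> x) = x"
    using homeomorphism_apply1[OF assms(3)] homeomorphism_apply2[OF assms(3)] by auto
  from assms(4) obtain G where G: "\<And>x. x \<in> W \<Longrightarrow> (\<psi> has_derivative G x) (at x)"
    "\<And>v. continuous_on W (\<lambda>x. G x v)"
    by (auto simp: numeral_eq_Suc)
  have linD: "linear D" and linG: "linear (G (\<phi> q))"
    using D G(1)[OF \<phi>q(2)] has_derivative_linear by blast+
  have GD: "G (\<phi> q) (D v) = v" for v
  proof -
    have "((\<lambda>x. \<psi> (\<phi> x)) has_derivative (\<lambda>v. G (\<phi> q) (D v))) (at q)"
      using has_derivative_compose[OF D G(1)[OF \<phi>q(2)]] .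
    then have "((\<lambda>x. x) has_derivative (\<lambda>v. G (\<phi> q) (D v))) (at q)"
      by (rule has_derivative_transform_within_open[OF _ assms(1) q(2)]) (use inv in auto)
    from fun_cong[OF has_derivative_unique[OF this has_derivative_ident], of v] show ?thesis by simp
  qed
  have DG: "D (G (\<phi> q) v) = v" for v
  proof -
    have "(\<phi> has_derivative D) (at (\<psi> (\<phi> q)))"
      using D inv q by simp
    from has_derivative_compose[OF G(1)[OF \<phi>q(2)] this]
    have "((\<lambda>x. \<phi> (\<psi> x)) has_derivative (\<lambda>v. D (G (\<phi> q) v))) (at (\<phi> q))" .
    then have "((\<lambda>x. x) has_derivative (\<lambda>v. D (G (\<phi> q) v))) (at (\<phi> q))"
      by (rule has_derivative_transform_within_open[OF _ assms(2) \<phi>q(2)]) (use inv in auto)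
    from fun_cong[OF has_derivative_unique[OF this has_derivative_ident], of v] show ?thesis by simp
  qed
  show eq: "tangent_space S q = {v. D v \<in> E}"
  proof (intro equalityI subsetI CollectI)
    fix v assume "v \<in> tangent_space S q"
    then show "D v \<in> E"
      by (rule derivative_along_tangent_in_subspace[OF _ has_derivative_at_withinI[OF D] assms(1) q(2) _ assms(5)])
        (use assms(6) in blast)
  next
    fix v assume "v \<in> {v. D v \<in> E}"
    then have v: "D v \<in> E" by simp
    define l where "l = (\<lambda>t::real. \<phi> q + t *\<^sub>R D v)"
    have l': "(l has_vector_derivative D v) (at t)" for t
      unfolding l_def by (auto intro!: derivative_eq_intros)
    have lc: "continuous_on UNIV l"
      unfolding l_def by (intro continuous_intros)
    then have "open (l -` W)"
      using assms(2) continuous_open_vimage[of W l] by (auto simp: continuous_on_eq_continuous_at)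
    moreover have "0 \<in> l -` W"
      using \<phi>q by (simp add: l_def)
    ultimately obtain \<epsilon> where \<epsilon>: "0 < \<epsilon>" "ball 0 \<epsilon> \<subseteq> l -` W"
      by (meson open_contains_ball)
    then have lW: "l t \<in> W" if "t \<in> {-\<epsilon><..<\<epsilon>}" for t
      using that by (auto simp: subset_iff)
    have lE: "l t \<in> E" for t
      unfolding l_def using assms(5) \<phi>q(1) v by (auto intro: subspace_add subspace_mul)
    have der: "((\<psi> \<circ> l) has_vector_derivative G (l t) (D v)) (at t)" if "t \<in> {-\<epsilon><..<\<epsilon>}" for t
      using vector_derivative_diff_chain_within[of l "D v" t UNIV \<psi> "G (l t)"] l' G(1)[OF lW[OF that]]
      by (auto intro: has_derivative_at_withinI)
    show "v \<in> tangent_space S q"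
      unfolding tangent_space_def
    proof (intro CollectI exI conjI)
      show "0 < \<epsilon>" by fact
      show "(\<psi> \<circ> l) C1_differentiable_on {-\<epsilon><..<\<epsilon>}"
        unfolding C1_differentiable_on_def
      proof (intro exI conjI ballI)
        show "continuous_on {-\<epsilon><..<\<epsilon>} (\<lambda>t. G (l t) (D v))"
          by (rule continuous_on_compose2[OF G(2)]) (use lW lc in \<open>auto intro: continuous_on_subset\<close>)
      qed (rule der)
      show "(\<psi> \<circ> l) ` {-\<epsilon><..<\<epsilon>} \<subseteq> S"
      proof clarify
        fix t assume "t \<in> {-\<epsilon><..<\<epsilon>}"
        with lW lE have "l t \<in> \<phi> ` (S \<inter> U)" using assms(6) by blast
        with inv(1) show "(\<psi> \<circ> l) t \<in> S" by auto
      qed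
      show "(\<psi> \<circ> l) 0 = q"
        using inv(1) q by (simp add: l_def)
      show "((\<psi> \<circ> l) has_vector_derivative v) (at 0)"
        using der[of 0] \<epsilon>(1) GD by (simp add: l_def)
    qed
  qed
  have "D ` tangent_space S q = E"
  proof
    show "E \<subseteq> D ` tangent_space S q"
    proof
      fix e assume "e \<in> E"
      then show "e \<in> D ` tangent_space S q"
        by (intro image_eqI[of _ _ "G (\<phi> q) e"]) (auto simp: eq DG)
    qed
  qed (auto simp: eq)
  moreover have "inj D"
    by (rule inj_on_inverseI[of _ "G (\<phi> q)"]) (rule GD)
  ultimately show "dim (tangent_space S q) = dim E"
    using dim_image_eq[OF linD inj_on_subset, of UNIV "tangent_space S q"] by auto
qed

lemma submanifold_chart:
  fixes S :: "'a::euclidean_space set"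
  assumes "submanifold \<kappa> d S" "at_least_C 1 \<kappa>" "q \<in> S"
  obtains U and \<phi> :: "'a \<Rightarrow> 'a" and D E where
    "open U" "q \<in> U" "of_class \<kappa> \<phi> U" "subspace E"
    "\<And>x. x \<in> U \<Longrightarrow> (\<phi> has_derivative D x) (at x)"
    "\<And>x. x \<in> S \<inter> U \<Longrightarrow> tangent_space S x = {v. D x v \<in> E}"
    "dim (tangent_space S q) = d"
proof -
  obtain U and W :: "'a set" and \<phi> \<psi> E where *: "open U" "q \<in> U" "open W"
    "homeomorphism U W \<phi> \<psi>" "of_class \<kappa> \<phi> U" "of_class \<kappa> \<psi> W" "subspace E" "dim E = d"
    "\<phi> ` (S \<inter> U) = E \<inter> W"
    using bspec[OF assms(1)[unfolded submanifold_def] assms(3)] by (elim exE conjE) (rule that)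
  note D = of_class_differentiable[OF *(5) assms(2)]
  note tangent = tangent_space_slice_chart[OF *(1,3,4) of_class_imp_Ck_on[OF *(6) assms(2)] *(7,9) _ _ D]
  show thesis
    by (rule that[OF *(1,2,5,7) D tangent(1)]) (use tangent(2)[of q] *(2,8) assms(3) in auto)
qed

lemma subspace_tangent_space:
  fixes S :: "'a::euclidean_space set"
  assumes "submanifold \<kappa> d S" "at_least_C 1 \<kappa>" "q \<in> S"
  shows "subspace (tangent_space S q)" and "dim (tangent_space S q) = d"
proof -
  obtain U and \<phi> :: "'a \<Rightarrow> 'a" and D E where *: "open U" "q \<in> U" "of_class \<kappa> \<phi> U" "subspace E"
    "\<And>x. x \<in> U \<Longrightarrow> (\<phi> has_derivative D x) (at x)"
    "\<And>x. x \<in> S \<inter> U \<Longrightarrow> tangent_space S x = {v. D x v \<in> E}"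
    "dim (tangent_space S q) = d"
    by (rule submanifold_chart[OF assms]) (rule that)
  show "dim (tangent_space S q) = d" by fact
  have "linear (D q)" using *(2,5) has_derivative_linear by blast
  from linear_subspace_vimage[OF this *(4)] *(2,6) assms(3)
  show "subspace (tangent_space S q)" by (simp add: vimage_def)
qed

lemma lie_bracket_in_tangent_space:
  fixes X Y :: "'a::euclidean_space \<Rightarrow> 'a"
  assumes "submanifold \<kappa> d S" "at_least_C 2 \<kappa>" "q \<in> S" "open V" "q \<in> V"
    and X: "\<And>x. x \<in> S \<inter> V \<Longrightarrow> X x \<in> tangent_space S x" "(X has_derivative DX) (at q)"
    and Y: "\<And>x. x \<in> S \<inter> V \<Longrightarrow> Y x \<in> tangent_space S x" "(Y has_derivative DY) (at q)"
  shows "DY (X q) - DX (Y q) \<in> tangent_space S q"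
proof -
  have "at_least_C 1 \<kappa>" using assms(2) by (cases \<kappa>) auto
  then obtain U and \<phi> :: "'a \<Rightarrow> 'a" and D E where *: "open U" "q \<in> U" "of_class \<kappa> \<phi> U" "subspace E"
    "\<And>x. x \<in> U \<Longrightarrow> (\<phi> has_derivative D x) (at x)"
    "\<And>x. x \<in> S \<inter> U \<Longrightarrow> tangent_space S x = {v. D x v \<in> E}"
    by (rule submanifold_chart[OF assms(1) _ assms(3)]) (rule that)
  have "Ck_on (Suc 1) \<phi> U"
    using of_class_imp_Ck_on[OF *(3), of 2] assms(2) by (simp add: numeral_2_eq_2)
  then have "Ck_on 1 (\<lambda>x. D x v) U" for v
    using Ck_on_partial_derivative[OF *(1)] *(5) by blast
  then have "\<forall>v. \<exists>D2. (\<forall>x\<in>U. ((\<lambda>x. D x v) has_derivative D2 x) (at x)) \<and> (\<forall>w. continuous_on U (\<lambda>x. D2 x w))"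
    by (simp add: numeral_eq_Suc)
  then obtain D2 where D2: "\<And>v x. x \<in> U \<Longrightarrow> ((\<lambda>x. D x v) has_derivative D2 v x) (at x)"
    "\<And>v w. continuous_on U (\<lambda>x. D2 v x w)"
    by metis
  have lin: "linear (D x)" if "x \<in> U" for x
    using that *(5) has_derivative_linear by blast
  have expand: "D x v = (\<Sum>b\<in>Basis. (v \<bullet> b) *\<^sub>R D x b)" if "x \<in> U" for x v
  proof -
    have "D x v = D x (\<Sum>b\<in>Basis. (v \<bullet> b) *\<^sub>R b)" by (simp add: euclidean_representation)
    also have "\<dots> = (\<Sum>b\<in>Basis. (v \<bullet> b) *\<^sub>R D x b)"
      using lin[OF that] by (simp add: linear_sum linear_cmul)
    finally show ?thesis .
  qed
  \<comment> \<open>\<open>D2 v\<close> was chosen for each \<open>v\<close> separately; its linear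
    dependence on \<open>v\<close> is recovered from the uniqueness of derivatives.\<close>
  have expand2: "D2 v q w = (\<Sum>b\<in>Basis. (v \<bullet> b) *\<^sub>R D2 b q w)" for v w
  proof -
    have "((\<lambda>x. \<Sum>b\<in>Basis. (v \<bullet> b) *\<^sub>R D x b) has_derivative (\<lambda>w. \<Sum>b\<in>Basis. (v \<bullet> b) *\<^sub>R D2 b q w)) (at q)"
      using D2(1)[OF *(2)] by (intro has_derivative_sum has_derivative_scaleR_right)
    then have "((\<lambda>x. D x v) has_derivative (\<lambda>w. \<Sum>b\<in>Basis. (v \<bullet> b) *\<^sub>R D2 b q w)) (at q)"
      by (rule has_derivative_transform_within_open[OF _ *(1,2)]) (simp add: expand)
    from fun_cong[OF has_derivative_unique[OF D2(1)[OF *(2)] this], of w] show ?thesis .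
  qed
  \<comment> \<open>The product rule for \<open>D x (Z x)\<close>, which lies in \<open>E\<close> on
    \<open>S\<close> near \<open>q\<close>. Expanding \<open>Z x\<close> in the standard basis needs
    only the derivatives of the finitely many maps \<open>D x b\<close>, never a derivative of an
    operator-valued map.\<close>
  have key: "D q (DZ w) + D2 (Z q) q w \<in> E"
    if Z: "\<And>x. x \<in> S \<inter> V \<Longrightarrow> Z x \<in> tangent_space S x" "(Z has_derivative DZ) (at q)"
      and w: "w \<in> tangent_space S q" for Z DZ w
  proof -
    have "((\<lambda>x. \<Sum>b\<in>Basis. (Z x \<bullet> b) *\<^sub>R D x b) has_derivative
        (\<lambda>w. \<Sum>b\<in>Basis. (Z q \<bullet> b) *\<^sub>R D2 b q w + (DZ w \<bullet> b) *\<^sub>R D q b)) (at q)"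
      by (intro has_derivative_sum has_derivative_scaleR has_derivative_inner_left Z(2) D2(1)[OF *(2)])
    then have "((\<lambda>x. D x (Z x)) has_derivative
        (\<lambda>w. \<Sum>b\<in>Basis. (Z q \<bullet> b) *\<^sub>R D2 b q w + (DZ w \<bullet> b) *\<^sub>R D q b)) (at q)"
      by (rule has_derivative_transform_within_open[OF _ *(1,2)]) (simp add: expand[symmetric])
    moreover have "(\<Sum>b\<in>Basis. (Z q \<bullet> b) *\<^sub>R D2 b q w + (DZ w \<bullet> b) *\<^sub>R D q b) = D q (DZ w) + D2 (Z q) q w" for w
      by (simp add: sum.distrib expand[OF *(2), of "DZ w"] expand2[of "Z q"])
    ultimately have "((\<lambda>x. D x (Z x)) has_derivative (\<lambda>w. D q (DZ w) + D2 (Z q) q w)) (at q)"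
      by simp
    from derivative_along_tangent_in_subspace[OF w has_derivative_at_withinI[OF this], of "U \<inter> V" E]
    show ?thesis
      using * assms(4,5) Z(1) by auto
  qed
  have XY: "X q \<in> tangent_space S q" "Y q \<in> tangent_space S q"
    using X Y assms(3,5) by auto
  have "D2 (X q) q (Y q) = D2 (Y q) q (X q)"
    by (rule second_derivative_symmetric[OF *(1,2,5) D2(1) D2(1) D2(2) D2(2)])
  with subspace_diff[OF *(4) key[OF Y XY(1)] key[OF X XY(2)]]
  have "D q (DY (X q) - DX (Y q)) \<in> E"
    using lin[OF *(2)] by (simp add: linear_diff)
  then show ?thesis
    using *(2,6) assms(3) by auto
qed

section \<open>The frames of a local generator\<close>

lemma at_least_C_mono: "at_least_C k \<kappa> \<Longrightarrow> j \<le> k \<Longrightarrow> at_least_C j \<kappa>"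
  by (cases \<kappa>) auto

lemma at_least_C_lose_derivs: "at_least_C (j + k) \<kappa> \<Longrightarrow> at_least_C k (lose_derivs j \<kappa>)"
  by (cases \<kappa>) auto

lemma lose_derivs_lose_derivs: "lose_derivs i (lose_derivs j \<kappa>) = lose_derivs (i + j) \<kappa>"
  by (cases \<kappa>) auto

section \<open>Complexification of real vector spaces\<close>

lemma bounded_bilinear_scaleC:
  "bounded_bilinear (scaleC :: complex \<Rightarrow> 'a::euclidean_space complexified \<Rightarrow> _)"
  unfolding bilinear_conv_bounded_bilinear[symmetric] bilinear_def
  by (auto intro!: linearI simp: scaleC_def algebra_simps)

lemma bounded_linear_conjC: "bounded_linear (conjC :: 'a::euclidean_space complexified \<Rightarrow> _)"
  unfolding linear_conv_bounded_linear[symmetric]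
  by (auto intro!: linearI simp: conjC_def)

lemma conjC_add: "conjC (v + w) = conjC v + conjC w"
  by (simp add: conjC_def)

lemma conjC_scaleC: "conjC (c *\<^sub>C v) = cnj c *\<^sub>C conjC v"
  by (simp add: conjC_def scaleC_def)

lemma scaleC_of_real: "of_real r *\<^sub>C v = r *\<^sub>R v"
  by (simp add: scaleC_def prod_eq_iff)

lemma subspace_complexified:
  assumes "subspace T"
  shows "cpx.subspace (T \<times> T)"
  using assms
  by (auto simp: cpx.subspace_def scaleC_def zero_prod_def
      intro: subspace_0 subspace_add subspace_diff subspace_mul)

lemma complexified_subset_span:
  assumes "T \<subseteq> span B"
  shows "T \<times> T \<subseteq> cpx.span ((\<lambda>b. (b, 0)) ` B)"
proof clarify
  let ?S = "cpx.span ((\<lambda>b. (b, 0)) ` B)"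
  have real: "(x, 0) \<in> ?S" if "x \<in> span B" for x
    using that
  proof (induction rule: span_induct_alt)
    case base
    then show ?case using cpx.span_zero by (simp add: zero_prod_def)
  next
    case (step c x y)
    have "of_real c *\<^sub>C (x, 0) + (y, 0) \<in> ?S"
      using step by (intro cpx.span_add cpx.span_scale) (auto intro: cpx.span_base)
    then show ?case by (simp add: scaleC_of_real)
  qed
  fix x y assume "x \<in> T" "y \<in> T"
  then have "(x, 0) + \<i> *\<^sub>C (y, 0) \<in> ?S"
    using assms by (intro cpx.span_add cpx.span_scale real) auto
  then show "(x, y) \<in> ?S" by (simp add: scaleC_def)
qed

text \<open>A real basis of \<open>T\<close> spans \<open>T \<times> T\<close> over the complex
  numbers. A vector outside the span of \<open>S\<close> would enlarge \<open>S\<close> to an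
  independent set with more than \<open>dim T\<close> elements inside a span of at most
  \<open>dim T\<close> vectors.\<close>

lemma complexified_span_eq:
  fixes T :: "'a::euclidean_space set"
  assumes "subspace T" "S \<subseteq> T \<times> T" "cpx.independent S" "finite S" "card S = dim T"
  shows "cpx.span S = T \<times> T"
proof
  show "cpx.span S \<subseteq> T \<times> T"
    by (rule cpx.span_minimal[OF assms(2) subspace_complexified[OF assms(1)]])
  obtain B where B: "B \<subseteq> T" "independent B" "T \<subseteq> span B" "card B = dim T"
    using basis_exists by blast
  let ?B = "(\<lambda>b. (b, 0::'a)) ` B"
  have fin: "finite B" using B(2) by (rule independent_imp_finite)
  show "T \<times> T \<subseteq> cpx.span S"
  proof
    fix v assume v: "v \<in> T \<times> T"
    show "v \<in> cpx.span S"
    proof (rule ccontr)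
      assume "v \<notin> cpx.span S"
      then have "cpx.independent (insert v S)" "v \<notin> S"
        using assms(3) cpx.independent_insertI[of v S] cpx.span_base[of v S] by blast+
      moreover have "insert v S \<subseteq> cpx.span ?B"
        using complexified_subset_span[OF B(3)] v assms(2) by blast
      ultimately have "card (insert v S) \<le> card ?B"
        using cpx.independent_span_bound[of ?B "insert v S"] fin by blast
      also have "\<dots> \<le> card B" by (rule card_image_le[OF fin])
      finally show False using \<open>v \<notin> S\<close> assms(4,5) B(4) by simp
    qed
  qed
qed

lemma cpx_independent_if_card_le_dim:
  assumes "finite S" "card S \<le> cpx.dim S"
  shows "cpx.independent S"
proof -
  obtain B where B: "B \<subseteq> S" "cpx.independent B" "S \<subseteq> cpx.span B" "card B = cpx.dim S"
    using cpx.basis_exists by blast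
  with assms have "B = S" by (intro card_seteq) auto
  with B show ?thesis by simp
qed

text \<open>For real-linear \<open>D\<close> this is its complex-linear extension to vectors
  \<open>X + \<i> Y\<close>.\<close>

definition complex_extension ::
    "('a::real_vector \<Rightarrow> 'b::real_vector complexified) \<Rightarrow> 'a complexified \<Rightarrow> 'b complexified" where
  "complex_extension D v = D (fst v) + \<i> *\<^sub>C D (snd v)"

text \<open>The four real brackets of real and imaginary parts recombine into the usual coordinate
  formula with complexified derivatives. All later computations use this form.\<close>

lemma lie_bracketC_eq:
  fixes K N :: "'a::euclidean_space \<Rightarrow> 'a complexified"
  assumes "submanifold \<kappa> d S" "at_least_C 1 \<kappa>" "q \<in> S" "open U" "q \<in> U"
    and KN: "K q \<in> CT S q" "N q \<in> CT S q"
    and K': "\<And>x. x \<in> S \<inter> U \<Longrightarrow> K' x = K x" "(K' has_derivative DK) (at q)"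
    and N': "\<And>x. x \<in> S \<inter> U \<Longrightarrow> N' x = N x" "(N' has_derivative DN) (at q)"
  shows "lie_bracketC S K N q = complex_extension DN (K q) - complex_extension DK (N q)"
proof -
  have *: "lie_bracket S (f \<circ> K) (g \<circ> N) q = g (DN (f (K q))) - f (DK (g (N q)))"
    if "f \<in> {fst, snd}" "g \<in> {fst, snd}" for f g :: "'a complexified \<Rightarrow> 'a"
  proof -
    have bl: "bounded_linear f" "bounded_linear g"
      using that bounded_linear_fst bounded_linear_snd by blast+
    have t: "f (K q) \<in> tangent_space S q" "g (N q) \<in> tangent_space S q"
      using that KN by (auto simp: CT_def)
    show ?thesis
      using lie_bracket_eq[of "f \<circ> K" q S "g \<circ> N" U "\<lambda>x. f (K' x)" "\<lambda>x. g (N' x)"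
          "\<lambda>v. f (DK v)" "\<lambda>v. g (DN v)"] t assms(3-5) K' N'
        bounded_linear.has_derivative[OF bl(1) K'(2)] bounded_linear.has_derivative[OF bl(2) N'(2)]
      by simp
  qed
  show ?thesis
    unfolding lie_bracketC_def
    by (simp add: * complex_extension_def scaleC_def prod_eq_iff)
qed

text \<open>The coordinate formula makes sense on all of \<open>U\<close> for the extensions
  \<open>X'\<close> and \<open>Y'\<close>. Only its values on \<open>S\<close> have a meaning as a
  bracket, but its smoothness is that of an ambient function.\<close>

lemma lie_bracket_extension:
  fixes X Y :: "'a::euclidean_space \<Rightarrow> 'a"
  assumes "submanifold \<kappa> d S" "at_least_C 2 \<kappa>" "open U" "at_least_C 1 \<mu>"
    and X: "of_class \<mu> X' U" "\<And>x. x \<in> S \<inter> U \<Longrightarrow> X' x = X x" "\<And>x. x \<in> S \<inter> U \<Longrightarrow> X x \<in> tangent_space S x"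
    and Y: "of_class \<mu> Y' U" "\<And>x. x \<in> S \<inter> U \<Longrightarrow> Y' x = Y x" "\<And>x. x \<in> S \<inter> U \<Longrightarrow> Y x \<in> tangent_space S x"
  obtains Z where "of_class (lose_derivs 1 \<mu>) Z U" "\<And>x. x \<in> S \<inter> U \<Longrightarrow> Z x = lie_bracket S X Y x"
    "\<And>x. x \<in> S \<inter> U \<Longrightarrow> Z x \<in> tangent_space S x"
proof
  let ?Z = "\<lambda>x. frechet_derivative Y' (at x) (X' x) - frechet_derivative X' (at x) (Y' x)"
  show "of_class (lose_derivs 1 \<mu>) ?Z U"
    using assms(3,4) X(1) Y(1)
    by (intro of_class_diff of_class_directional_derivative of_class_lose_derivs)
  fix x assume x: "x \<in> S \<inter> U"
  have D: "(X' has_derivative frechet_derivative X' (at x)) (at x)"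
    "(Y' has_derivative frechet_derivative Y' (at x)) (at x)"
    using x of_class_differentiable[OF X(1) assms(4)] of_class_differentiable[OF Y(1) assms(4)] by auto
  show "?Z x = lie_bracket S X Y x"
    using lie_bracket_eq[of X x S Y U X' Y', OF _ _ _ assms(3) _ X(2) Y(2) D] X Y x by auto
  show "?Z x \<in> tangent_space S x"
    by (rule lie_bracket_in_tangent_space[OF assms(1,2) _ assms(3) _ _ D(1) _ D(2)]) (use x X Y in auto)
qed

lemma local_generator_extension:
  assumes "local_generator \<kappa> M V L" "q \<in> V"
  obtains U L' where "open U" "q \<in> U" "M \<inter> U \<subseteq> V" "of_class (lose_derivs 1 \<kappa>) L' U"
    "\<And>x. x \<in> M \<inter> U \<Longrightarrow> L' x = L x"
proof -
  from assms obtain U1 L' where U1: "open U1" "q \<in> U1" "of_class (lose_derivs 1 \<kappa>) L' U1"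
    "\<forall>x\<in>U1 \<inter> V. L' x = L x"
    unfolding local_generator_def of_class_sub_def by blast
  from assms(1) obtain U2 where U2: "open U2" "V = M \<inter> U2"
    unfolding local_generator_def openin_open by blast
  show thesis
    by (rule that[of "U1 \<inter> U2" L']) (use U1 U2 assms(2) in \<open>auto intro: of_class_subset\<close>)
qed

lemma lie_bracketC_extension:
  fixes K N :: "'a::euclidean_space \<Rightarrow> 'a complexified"
  assumes "submanifold \<kappa> d S" "at_least_C 2 \<kappa>" "open U" "at_least_C 1 \<mu>"
    and K: "of_class \<mu> K' U" "\<And>x. x \<in> S \<inter> U \<Longrightarrow> K' x = K x" "\<And>x. x \<in> S \<inter> U \<Longrightarrow> K x \<in> CT S x"
    and N: "of_class \<mu> N' U" "\<And>x. x \<in> S \<inter> U \<Longrightarrow> N' x = N x" "\<And>x. x \<in> S \<inter> U \<Longrightarrow> N x \<in> CT S x"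
  obtains Z where "of_class (lose_derivs 1 \<mu>) Z U" "\<And>x. x \<in> S \<inter> U \<Longrightarrow> Z x = lie_bracketC S K N x"
    "\<And>x. x \<in> S \<inter> U \<Longrightarrow> Z x \<in> CT S x"
proof -
  have *: "\<exists>Z. of_class (lose_derivs 1 \<mu>) Z U \<and>
      (\<forall>x\<in>S \<inter> U. Z x = lie_bracket S (f \<circ> K) (g \<circ> N) x \<and> Z x \<in> tangent_space S x)"
    if "f \<in> {fst, snd}" "g \<in> {fst, snd}" for f g :: "'a complexified \<Rightarrow> 'a"
  proof -
    have bl: "bounded_linear f" "bounded_linear g"
      using that bounded_linear_fst bounded_linear_snd by blast+
    have t: "f v \<in> tangent_space S x" "g v \<in> tangent_space S x" if "v \<in> CT S x" for v x
      using that \<open>f \<in> {fst, snd}\<close> \<open>g \<in> {fst, snd}\<close> by (auto simp: CT_def)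
    obtain Z where "of_class (lose_derivs 1 \<mu>) Z U"
      "\<And>x. x \<in> S \<inter> U \<Longrightarrow> Z x = lie_bracket S (f \<circ> K) (g \<circ> N) x"
      "\<And>x. x \<in> S \<inter> U \<Longrightarrow> Z x \<in> tangent_space S x"
      by (rule lie_bracket_extension[OF assms(1-4) of_class_bounded_linear[OF bl(1) K(1)] _ _
            of_class_bounded_linear[OF bl(2) N(1)], of "f \<circ> K" "g \<circ> N"])
        (use K N t in auto)
    then show ?thesis by blast
  qed
  obtain Z1 where Z1: "of_class (lose_derivs 1 \<mu>) Z1 U"
    "\<forall>x\<in>S \<inter> U. Z1 x = lie_bracket S (fst \<circ> K) (fst \<circ> N) x \<and> Z1 x \<in> tangent_space S x"
    using *[of fst fst] by auto
  obtain Z2 where Z2: "of_class (lose_derivs 1 \<mu>) Z2 U"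
    "\<forall>x\<in>S \<inter> U. Z2 x = lie_bracket S (snd \<circ> K) (snd \<circ> N) x \<and> Z2 x \<in> tangent_space S x"
    using *[of snd snd] by auto
  obtain Z3 where Z3: "of_class (lose_derivs 1 \<mu>) Z3 U"
    "\<forall>x\<in>S \<inter> U. Z3 x = lie_bracket S (fst \<circ> K) (snd \<circ> N) x \<and> Z3 x \<in> tangent_space S x"
    using *[of fst snd] by auto
  obtain Z4 where Z4: "of_class (lose_derivs 1 \<mu>) Z4 U"
    "\<forall>x\<in>S \<inter> U. Z4 x = lie_bracket S (snd \<circ> K) (fst \<circ> N) x \<and> Z4 x \<in> tangent_space S x"
    using *[of snd fst] by auto
  show thesis
  proof (rule that[of "\<lambda>x. (Z1 x - Z2 x, Z3 x + Z4 x)"])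
    show "of_class (lose_derivs 1 \<mu>) (\<lambda>x. (Z1 x - Z2 x, Z3 x + Z4 x)) U"
      using Z1(1) Z2(1) Z3(1) Z4(1) by (intro of_class_Pair of_class_diff of_class_add)
    fix x assume x: "x \<in> S \<inter> U"
    show "(Z1 x - Z2 x, Z3 x + Z4 x) = lie_bracketC S K N x"
      using x Z1 Z2 Z3 Z4 by (simp add: lie_bracketC_def)
    have "at_least_C 1 \<kappa>" by (rule at_least_C_mono[OF assms(2)]) simp
    then have "subspace (tangent_space S x)"
      using subspace_tangent_space(1)[OF assms(1)] x by blast
    then show "(Z1 x - Z2 x, Z3 x + Z4 x) \<in> CT S x"
      unfolding CT_def using x Z1(2) Z2(2) Z3(2) Z4(2)
      by (intro SigmaI subspace_add subspace_diff) blast+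
  qed
qed

lemma conjC_in_CT:
  assumes "subspace (tangent_space S q)" "v \<in> CT S q"
  shows "conjC v \<in> CT S q"
  using assms by (auto simp: CT_def conjC_def intro: subspace_neg)

text \<open>For a pair \<open>(X, Y)\<close> the eigenvector equation reads
  \<open>\<i> *s X = - Y\<close>: a (1,0) vector is determined by its real part.\<close>

lemma local_generatorD:
  assumes "local_generator \<kappa> M V L" "q \<in> V"
  shows "q \<in> M" "L q \<in> CT M q" "L q \<noteq> 0" "snd (L q) = - (\<i> *s fst (L q))"
proof -
  show "q \<in> M"
    using assms unfolding local_generator_def openin_open by blast
  have "L q \<in> T10 M q" "L q \<noteq> 0"
    using assms unfolding local_generator_def by blast+
  then show "L q \<in> CT M q" "L q \<noteq> 0" "snd (L q) = - (\<i> *s fst (L q))"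
    by (auto simp: T10_def scaleC_def prod_eq_iff)
qed

lemma local_generator_complex_line:
  assumes "submanifold \<kappa> d M" "at_least_C 1 \<kappa>" "local_generator \<kappa> M V L" "q \<in> V"
  shows "fst (L q) \<noteq> 0" "fst (L q) \<in> tangent_space M q" "\<i> *s fst (L q) \<in> tangent_space M q"
proof -
  note L = local_generatorD[OF assms(3,4)]
  show "fst (L q) \<noteq> 0"
    using L(3,4) by (auto simp: prod_eq_iff)
  show "fst (L q) \<in> tangent_space M q"
    using L(2) by (auto simp: CT_def)
  have "- snd (L q) \<in> tangent_space M q"
    using L(2) subspace_neg[OF subspace_tangent_space(1)[OF assms(1,2) L(1)]] by (auto simp: CT_def)
  then show "\<i> *s fst (L q) \<in> tangent_space M q"
    using L(4) by simp
qed

lemma cr_frame_local_frame: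
  assumes "at_least_C 3 \<kappa>" "real_hypersurface \<kappa> M" "general_class_I \<kappa> M" and L: "local_generator \<kappa> M V L"
  shows "local_frame (lose_derivs 2 \<kappa>) M V (cr_frame M L)"
proof -
  have sub: "submanifold \<kappa> 3 M"
    using assms(2) by (simp add: real_hypersurface_def)
  have \<kappa>: "at_least_C 2 \<kappa>" "at_least_C 1 \<kappa>" "at_least_C 1 (lose_derivs 1 \<kappa>)"
    using at_least_C_mono[OF assms(1)] at_least_C_lose_derivs[of 1 1 \<kappa>] by (auto simp: numeral_eq_Suc)
  have lose: "lose_derivs 1 (lose_derivs 1 \<kappa>) = lose_derivs 2 \<kappa>"
    by (simp add: lose_derivs_lose_derivs numeral_2_eq_2)
  let ?W = "lie_bracketC M L (conjC \<circ> L)"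
  have conj: "conjC (L x) \<in> CT M x" if "x \<in> V" for x
    using local_generatorD[OF L that] subspace_tangent_space(1)[OF sub \<kappa>(2)] by (auto intro: conjC_in_CT)
  have ext: "\<exists>U L' Z. open U \<and> q \<in> U \<and> M \<inter> U \<subseteq> V \<and> of_class (lose_derivs 1 \<kappa>) L' U \<and> (\<forall>x\<in>M \<inter> U. L' x = L x) \<and>
      of_class (lose_derivs 2 \<kappa>) Z U \<and> (\<forall>x\<in>M \<inter> U. Z x = ?W x \<and> Z x \<in> CT M x)" if q: "q \<in> V" for q
  proof -
    obtain U L' where U: "open U" "q \<in> U" "M \<inter> U \<subseteq> V" "of_class (lose_derivs 1 \<kappa>) L' U"
      "\<And>x. x \<in> M \<inter> U \<Longrightarrow> L' x = L x"
      by (rule local_generator_extension[OF L q]) (rule that)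
    obtain Z where "of_class (lose_derivs 1 (lose_derivs 1 \<kappa>)) Z U"
      "\<And>x. x \<in> M \<inter> U \<Longrightarrow> Z x = ?W x" "\<And>x. x \<in> M \<inter> U \<Longrightarrow> Z x \<in> CT M x"
      by (rule lie_bracketC_extension[OF sub \<kappa>(1) U(1) \<kappa>(3) U(4) _ _
            of_class_bounded_linear[OF bounded_linear_conjC U(4)], of L "conjC \<circ> L"])
        (use U local_generatorD[OF L] conj in auto)
    then show ?thesis
      using U unfolding lose by blast
  qed
  have "openin (top_of_set M) V"
    using L by (simp add: local_generator_def)
  moreover have "of_class_sub (lose_derivs 2 \<kappa>) (\<lambda>q. cr_frame M L q $ i) V" for i
    unfolding of_class_sub_def
  proof
    fix q assume "q \<in> V"
    with ext[OF this] obtain U L' Z where U: "open U" "q \<in> U" "of_class (lose_derivs 1 \<kappa>) L' U" "\<forall>x\<in>M \<inter> U. L' x = L x"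
      "of_class (lose_derivs 2 \<kappa>) Z U" "\<forall>x\<in>M \<inter> U. Z x = ?W x"
      by auto
    have L': "of_class (lose_derivs 2 \<kappa>) L' U"
      using of_class_lose_derivs[OF U(3), of 1] unfolding lose .
    have VM: "x \<in> M" if "x \<in> V" for x
      using local_generatorD(1)[OF L that] .
    have "\<exists>g. of_class (lose_derivs 2 \<kappa>) g U \<and> (\<forall>x\<in>U \<inter> V. g x = cr_frame M L x $ i)"
    proof -
      consider "i = 1" | "i = 2" | "i = 3" using exhaust_3 by blast
      then show ?thesis
      proof cases
        case 1
        with L' U(4) VM show ?thesis by (intro exI[of _ L']) (auto simp: cr_frame_def)
      next
        case 2
        with of_class_bounded_linear[OF bounded_linear_conjC L'] U(4) VM show ?thesis
          by (intro exI[of _ "\<lambda>x. conjC (L' x)"]) (auto simp: cr_frame_def)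
      next
        case 3
        with of_class_bounded_linear[OF bounded_bilinear.bounded_linear_right[OF bounded_bilinear_scaleC] U(5)] U(6) VM
        show ?thesis
          by (intro exI[of _ "\<lambda>x. \<i> *\<^sub>C Z x"]) (auto simp: cr_frame_def)
      qed
    qed
    with U(1,2) show "\<exists>U g. open U \<and> q \<in> U \<and> of_class (lose_derivs 2 \<kappa>) g U \<and>
        (\<forall>x\<in>U \<inter> V. g x = cr_frame M L x $ i)"
      by blast
  qed
  moreover have "inj (($) (cr_frame M L q)) \<and> cpx.independent (range (($) (cr_frame M L q))) \<and>
       cpx.span (range (($) (cr_frame M L q))) = CT M q" if q: "q \<in> V" for q
  proof -
    let ?S = "{L q, conjC (L q), ?W q}" and ?F = "{L q, conjC (L q), \<i> *\<^sub>C ?W q}"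
    have range: "range (($) (cr_frame M L q)) = ?F"
      unfolding UNIV_3 by (simp add: cr_frame_def)
    have T: "subspace (tangent_space M q)" "dim (tangent_space M q) = 3"
      using subspace_tangent_space[OF sub \<kappa>(2)] local_generatorD(1)[OF L q] by blast+
    have W: "?W q \<in> CT M q"
      using ext[OF q] local_generatorD(1)[OF L q] by force
    have "\<i> *\<^sub>C ?W q \<in> CT M q"
      using cpx.subspace_scale[OF subspace_complexified[OF T(1)], of "?W q" \<i>] W by (simp add: CT_def)
    then have F: "?F \<subseteq> CT M q"
      using local_generatorD(2)[OF L q] conj[OF q] by blast
    \<comment> \<open>The rank condition concerns the bracket itself, the frame its multiple by
      \<i>; undoing the factor shows that both triples have the same span.\<close>
    have "?W q = (- \<i>) *\<^sub>C (\<i> *\<^sub>C ?W q)" by simp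
    then have "?W q \<in> cpx.span ?F"
      by (metis cpx.span_base cpx.span_scale insertI1 insertI2)
    then have "?S \<subseteq> cpx.span ?F"
      by (auto intro: cpx.span_base)
    moreover have "?F \<subseteq> cpx.span ?S"
      by (auto intro: cpx.span_base cpx.span_scale)
    ultimately have "cpx.dim ?F = cpx.dim ?S"
      by (intro cpx.span_eq_dim) (simp add: cpx.span_eq)
    also have "\<dots> = 3"
      using assms(3) L q by (simp add: general_class_I_def)
    finally have dim: "cpx.dim ?F = 3" .
    have "cpx.dim ?F \<le> card ?F" by (rule cpx.dim_le_card') simp
    moreover have "card ?F \<le> 3"
      by (simp add: card_insert_if)
    \<comment> \<open>Rank 3 excludes coincidences among the three vectors. This count gives
      independence, injectivity of the enumeration, and equality with the real dimension of the
      tangent space.\<close>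
    ultimately have card: "card ?F = 3" using dim by simp
    then have indep: "cpx.independent ?F"
      using dim by (intro cpx_independent_if_card_le_dim) auto
    have "inj (($) (cr_frame M L q))"
      by (rule eq_card_imp_inj_on) (use card range in auto)
    moreover have "cpx.span ?F = CT M q"
      unfolding CT_def
      by (rule complexified_span_eq[OF T(1) _ indep]) (use F T(2) card in \<open>auto simp: CT_def\<close>)
    ultimately show ?thesis
      unfolding range using indep by blast
  qed
  ultimately show ?thesis
    unfolding local_frame_def by blast
qed

section \<open>The initial structure group\<close>

text \<open>The parameters \<open>a\<close> and \<open>b\<close> are read off the first column,
  which turns the parametrization into equations between entries.\<close>

lemma G_I_initial_iff:
  "A \<in> G_I_initial \<longleftrightarrow> A$1$1 \<noteq> 0 \<and> A$1$2 = 0 \<and> A$1$3 = 0 \<and> A$2$1 = 0 \<and> A$2$2 = cnj (A$1$1) \<and>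
    A$2$3 = 0 \<and> A$3$2 = cnj (A$3$1) \<and> A$3$3 = A$1$1 * cnj (A$1$1)"
proof
  assume "A$1$1 \<noteq> 0 \<and> A$1$2 = 0 \<and> A$1$3 = 0 \<and> A$2$1 = 0 \<and> A$2$2 = cnj (A$1$1) \<and>
    A$2$3 = 0 \<and> A$3$2 = cnj (A$3$1) \<and> A$3$3 = A$1$1 * cnj (A$1$1)"
  then show "A \<in> G_I_initial"
    unfolding G_I_initial_def
    by (intro CollectI exI[of _ "A$1$1"] exI[of _ "A$3$1"]) (simp add: vec_eq_iff forall_3)
qed (auto simp: G_I_initial_def)

lemma group_GL: "group (GL :: (complex^'n^'n) monoid)"
proof (rule groupI)
  fix A :: "complex^'n^'n" assume "A \<in> carrier GL"
  then obtain B where "A ** B = mat 1" "B ** A = mat 1"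
    by (auto simp: GL_def invertible_def)
  then show "\<exists>B\<in>carrier GL. B \<otimes>\<^bsub>GL\<^esub> A = \<one>\<^bsub>GL\<^esub>"
    by (auto simp: GL_def invertible_def)
qed (auto simp: GL_def invertible_mult matrix_mul_assoc, auto simp: invertible_def)

lemma G_I_initial_subset_GL: "G_I_initial \<subseteq> carrier GL"
  by (auto simp: G_I_initial_iff GL_def invertible_det_nz det_3)

text \<open>The condition that \<open>a\<close> is nonzero is not closed, but inside the general
  linear group it is automatic: a matrix satisfying the remaining, closed equations has determinant
  the square of \<open>a * cnj a\<close>.\<close>

lemma closed_subgroup_G_I_initial: "closed_subgroup_GL G_I_initial"
  unfolding closed_subgroup_GL_def
proof
  show "subgroup G_I_initial GL"
  proof (rule group.subgroupI[OF group_GL])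
    show "G_I_initial \<subseteq> carrier GL"
      by (rule G_I_initial_subset_GL)
    have "mat 1 \<in> G_I_initial"
      by (simp add: G_I_initial_iff mat_def)
    then show "G_I_initial \<noteq> {}" by blast
    fix A assume A: "A \<in> G_I_initial"
    let ?a = "A$1$1" and ?b = "A$3$1"
    \<comment> \<open>The inverse has parameters \<open>1 / a\<close> and
      \<open>- b / (a * a * cnj a)\<close>, found by solving the lower left entry of
      \<open>B ** A\<close> for 0.\<close>
    define B :: "complex^3^3" where "B = vector [vector [1 / ?a, 0, 0], vector [0, 1 / cnj ?a, 0],
      vector [- ?b / (?a * ?a * cnj ?a), - cnj ?b / (cnj ?a * cnj ?a * ?a), 1 / (?a * cnj ?a)]]"
    have B: "B \<in> G_I_initial"
      using A by (simp add: B_def G_I_initial_iff)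
    have "B ** A = mat 1"
      using A by (simp add: B_def G_I_initial_iff vec_eq_iff forall_3 matrix_matrix_mult_def sum_3 mat_def field_simps)
    then have "inv\<^bsub>GL\<^esub> A = B"
      using A B G_I_initial_subset_GL
      by (intro group.inv_equality[OF group_GL]) (auto simp: GL_def)
    with B show "inv\<^bsub>GL\<^esub> A \<in> G_I_initial" by simp
    fix B assume "B \<in> G_I_initial"
    with A show "A \<otimes>\<^bsub>GL\<^esub> B \<in> G_I_initial"
      by (simp add: GL_def G_I_initial_iff matrix_matrix_mult_def sum_3)
  qed
  define C :: "(complex^3^3) set" where "C = {A. A$1$2 = 0 \<and> A$1$3 = 0 \<and> A$2$1 = 0 \<and> A$2$2 = cnj (A$1$1) \<and>
    A$2$3 = 0 \<and> A$3$2 = cnj (A$3$1) \<and> A$3$3 = A$1$1 * cnj (A$1$1)}"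
  have "closed C"
    unfolding C_def by (intro closed_Collect_conj closed_Collect_eq continuous_intros)
  moreover have "G_I_initial = carrier GL \<inter> C"
    by (auto simp: G_I_initial_iff GL_def invertible_det_nz det_3 C_def)
  ultimately show "closedin (top_of_set (carrier GL)) G_I_initial"
    by (auto simp: closedin_closed)
qed

text \<open>A single global chart straightens the group. \<open>N\<close> collects the entries that
  membership prescribes in terms of \<open>A$1$1\<close> and \<open>A$3$1\<close>, and it changes
  neither of these two; subtracting \<open>N A\<close> is thus a shear with inverse
  \<open>A + N A\<close>. It carries the group to the matrices whose other entries vanish, with
  \<open>A$1$1\<close> nonzero, an open part of a real four-dimensional subspace.\<close>

lemma submanifold_G_I_initial: "submanifold C_infinity 4 G_I_initial"
proof -
  define l :: "complex^3^3 \<Rightarrow> complex^3^3" where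
    "l A = vector [0, vector [0, cnj (A$1$1), 0], vector [0, cnj (A$3$1), 0]]" for A
  \<comment> \<open>The quadratic entry \<open>a * cnj a\<close> is the diagonal of a real-bilinear
    map, so the smoothness of \<open>N\<close> reduces to bounded linear and bilinear maps.\<close>
  define h :: "complex^3^3 \<Rightarrow> complex^3^3 \<Rightarrow> complex^3^3" where
    "h A B = vector [0, 0, vector [0, 0, A$1$1 * cnj (B$1$1)]]" for A B
  define N where "N A = l A + h A A" for A
  have "linear l"
    by (rule linearI) (simp_all add: l_def vec_eq_iff forall_3)
  then have l: "bounded_linear l" by (simp add: linear_conv_bounded_linear)
  have "bilinear h"
    unfolding bilinear_def
    by (intro conjI allI linearI) (simp_all add: h_def vec_eq_iff forall_3 algebra_simps)
  then have h: "bounded_bilinear h" by (simp add: bilinear_conv_bounded_bilinear)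
  have id: "of_class C_infinity (\<lambda>A. A) U" for U :: "(complex^3^3) set"
    by (simp add: Ck_on_ident)
  have N: "of_class C_infinity N U" for U
    unfolding N_def
    by (intro of_class_add of_class_bounded_linear[OF l] of_class_bounded_bilinear[OF h] id)
  let ?\<phi> = "\<lambda>A. A - N A" and ?\<psi> = "\<lambda>A. A + N A"
  have \<phi>: "of_class C_infinity ?\<phi> U" and \<psi>: "of_class C_infinity ?\<psi> U" for U
    by (intro of_class_add of_class_diff id N)+
  then have cont: "continuous_on U ?\<phi>" "continuous_on U ?\<psi>" for U
    by (meson of_class_imp_Ck_on at_least_C.simps(2) Ck_on_imp_continuous_on)+
  define U :: "(complex^3^3) set" where "U = {A. A$1$1 \<noteq> 0}"
  have "open U"
    unfolding U_def by (intro open_Collect_neq continuous_intros)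
  have N0: "N A$1$1 = 0" "N A$3$1 = 0" for A
    by (simp_all add: N_def l_def h_def)
  have N_cong: "N A = N B" if "A$1$1 = B$1$1" "A$3$1 = B$3$1" for A B
    using that by (simp add: N_def l_def h_def)
  have NN: "N (A - N B) = N A" "N (A + N B) = N A" for A B
    by (rule N_cong; simp add: N0)+
  have homeo: "homeomorphism U U ?\<phi> ?\<psi>"
    by (rule homeomorphismI[OF cont]) (auto simp: U_def N0 NN)
  define f :: "complex \<times> complex \<Rightarrow> complex^3^3" where
    "f p = vector [vector [fst p, 0, 0], 0, vector [snd p, 0, 0]]" for p
  have f: "linear f"
    by (rule linearI) (simp_all add: f_def vec_eq_iff forall_3)
  have "inj f"
    by (auto intro!: injI simp: f_def vec_eq_iff forall_3 prod_eq_iff)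
  then have dim: "dim (range f) = 4"
    using dim_image_eq[OF f, of UNIV] by simp
  have range_iff: "?\<phi> A \<in> range f \<longleftrightarrow> A \<in> G_I_initial" if "A \<in> U" for A
  proof -
    have "?\<phi> A \<in> range f \<longleftrightarrow> ?\<phi> A = f (A$1$1, A$3$1)"
    proof
      assume "?\<phi> A \<in> range f"
      then obtain p where "?\<phi> A = f p" by blast
      then have "?\<phi> A$1$1 = f p$1$1" "?\<phi> A$3$1 = f p$3$1" by simp_all
      then have "p = (A$1$1, A$3$1)" by (simp add: N0 f_def prod_eq_iff)
      with \<open>?\<phi> A = f p\<close> show "?\<phi> A = f (A$1$1, A$3$1)" by simp
    qed simp
    also have "\<dots> \<longleftrightarrow> A \<in> G_I_initial"
      using that by (auto simp: U_def G_I_initial_iff N_def l_def h_def f_def vec_eq_iff forall_3)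
    finally show ?thesis .
  qed
  have image: "?\<phi> ` (G_I_initial \<inter> U) = range f \<inter> U"
  proof (intro equalityI subsetI)
    fix B assume "B \<in> ?\<phi> ` (G_I_initial \<inter> U)"
    then obtain A where "A \<in> G_I_initial" "A \<in> U" "B = ?\<phi> A" by blast
    then show "B \<in> range f \<inter> U"
      using range_iff[of A] by (simp add: U_def N0)
  next
    fix B assume B: "B \<in> range f \<inter> U"
    have "?\<psi> B \<in> U" "?\<phi> (?\<psi> B) = B"
      using B by (simp_all add: U_def N0 NN)
    then show "B \<in> ?\<phi> ` (G_I_initial \<inter> U)"
      using B range_iff[of "?\<psi> B"] by (intro image_eqI[of _ _ "?\<psi> B"]) auto
  qed
  have "G_I_initial \<subseteq> U"
    by (auto simp: G_I_initial_iff U_def)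
  show ?thesis
    unfolding submanifold_def
  proof (intro ballI, rule exI[of _ U], rule exI[of _ U], rule exI[of _ ?\<phi>], rule exI[of _ ?\<psi>],
      rule exI[of _ "range f"], intro conjI)
    fix p assume "p \<in> G_I_initial"
    then show "p \<in> U"
      using \<open>G_I_initial \<subseteq> U\<close> by blast
    show "subspace (range f)"
      using linear_subspace_image[OF f subspace_UNIV] .
  qed (rule \<open>open U\<close> homeo \<phi> \<psi> dim image)+
qed

section \<open>Change of generator\<close>

lemma vector_scale_complex: "c *s x = Re c *\<^sub>R x + Im c *\<^sub>R (\<i> *s x)" for x :: "complex^'n"
  by (simp add: vec_eq_iff complex_eq_iff)

text \<open>If \<open>x\<close> and \<open>y\<close> were independent over the complex numbers, then
  \<open>x\<close>, \<open>\<i> *s x\<close>, \<open>y\<close> and \<open>\<i> *s y\<close> would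
  span the whole real four-dimensional space inside \<open>T\<close>. The proportionality factor is
  given as a quotient of coordinates, so that its regularity can be read off.\<close>

lemma complex_line_in_real_hyperplane:
  fixes T :: "(complex^2) set"
  assumes "subspace T" "dim T = 3" "x \<in> T" "\<i> *s x \<in> T" "y \<in> T" "\<i> *s y \<in> T" "x$j \<noteq> 0"
  shows "y = (y$j / x$j) *s x"
proof -
  define \<Delta> where "\<Delta> = x$1 * y$2 - x$2 * y$1"
  have "\<Delta> = 0"
  proof (rule ccontr)
    assume "\<Delta> \<noteq> 0"
    have "w \<in> T" for w
    proof -
      \<comment> \<open>The coefficients of \<open>w\<close> in the basis \<open>x\<close>,
        \<open>y\<close> by Cramer's rule.\<close>
      define \<alpha> where "\<alpha> = (w$1 * y$2 - w$2 * y$1) / \<Delta>"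
      define \<beta> where "\<beta> = (x$1 * w$2 - x$2 * w$1) / \<Delta>"
      have "\<alpha> *s x + \<beta> *s y \<in> T"
        using assms(1-6) unfolding vector_scale_complex[of \<alpha>] vector_scale_complex[of \<beta>]
        by (intro subspace_add subspace_mul)
      moreover have "w = \<alpha> *s x + \<beta> *s y"
      proof -
        have "w$1 * \<Delta> = (w$1 * y$2 - w$2 * y$1) * x$1 + (x$1 * w$2 - x$2 * w$1) * y$1"
          "w$2 * \<Delta> = (w$1 * y$2 - w$2 * y$1) * x$2 + (x$1 * w$2 - x$2 * w$1) * y$2"
          by (simp_all add: \<Delta>_def algebra_simps)
        then have "w$1 = ((w$1 * y$2 - w$2 * y$1) * x$1 + (x$1 * w$2 - x$2 * w$1) * y$1) / \<Delta>"
          "w$2 = ((w$1 * y$2 - w$2 * y$1) * x$2 + (x$1 * w$2 - x$2 * w$1) * y$2) / \<Delta>"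
          using \<open>\<Delta> \<noteq> 0\<close> nonzero_eq_divide_eq by blast+
        then have "w$1 = \<alpha> * x$1 + \<beta> * y$1" "w$2 = \<alpha> * x$2 + \<beta> * y$2"
          by (simp_all only: \<alpha>_def \<beta>_def add_divide_distrib times_divide_eq_left)
        then show ?thesis by (simp add: vec_eq_iff forall_2)
      qed
      ultimately show ?thesis by simp
    qed
    then have "T = UNIV" by blast
    then show False using assms(2) by simp
  qed
  moreover have "j = 1 \<or> j = 2" by (rule exhaust_2)
  ultimately show ?thesis
    using assms(7) by (auto simp: vec_eq_iff forall_2 \<Delta>_def field_simps)
qed

lemma complex_extension_scaleC:
  fixes D :: "'a::real_vector \<Rightarrow> 'b::real_vector complexified"
  assumes "linear D"
  shows "complex_extension D (c *\<^sub>C v) = c *\<^sub>C complex_extension D v"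
  using assms
  by (simp add: complex_extension_def scaleC_def linear_add linear_diff linear_cmul prod_eq_iff algebra_simps)

text \<open>The Leibniz rule: differentiating the factor \<open>a\<close> yields a multiple of
  \<open>L\<close>, differentiating \<open>cnj a\<close> a multiple of its conjugate.
  Differentiability of \<open>a\<close> and of the extension of \<open>L\<close> at the single point
  \<open>q\<close> suffices.\<close>

lemma lie_bracketC_conj_rescale:
  fixes L :: "'a::euclidean_space \<Rightarrow> 'a complexified" and a :: "'a \<Rightarrow> complex"
  assumes "submanifold \<kappa> d S" "at_least_C 1 \<kappa>" "q \<in> S" "open U" "q \<in> U"
    and L: "\<And>x. x \<in> S \<inter> U \<Longrightarrow> L x \<in> CT S x" "\<And>x. x \<in> S \<inter> U \<Longrightarrow> L' x \<in> CT S x"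
    and E: "\<And>x. x \<in> S \<inter> U \<Longrightarrow> E x = L x" "(E has_derivative D) (at q)"
    and a: "\<And>x. x \<in> S \<inter> U \<Longrightarrow> L' x = a x *\<^sub>C L x" "(a has_derivative a') (at q)"
  obtains \<gamma> where "lie_bracketC S L' (conjC \<circ> L') q =
    (a q * cnj (a q)) *\<^sub>C lie_bracketC S L (conjC \<circ> L) q + \<gamma> *\<^sub>C conjC (L q) - cnj \<gamma> *\<^sub>C L q"
proof -
  have T: "subspace (tangent_space S q)"
    using subspace_tangent_space[OF assms(1-3)] by blast
  let ?E' = "\<lambda>x. a x *\<^sub>C E x"
  let ?D' = "\<lambda>v. a q *\<^sub>C D v + a' v *\<^sub>C E q"
  note conj = bounded_linear.has_derivative[OF bounded_linear_conjC]
  have E': "(?E' has_derivative ?D') (at q)"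
    by (rule bounded_bilinear.FDERIV[OF bounded_bilinear_scaleC a(2) E(2)])
  have q: "q \<in> S \<inter> U" "E q = L q" using assms(3,5) E(1) by auto
  have lin: "linear D" "linear a'" "linear (\<lambda>v. conjC (D v))"
    using E(2) a(2) conj[OF E(2)] has_derivative_linear by blast+
  have W: "lie_bracketC S L (conjC \<circ> L) q =
      complex_extension (\<lambda>v. conjC (D v)) (L q) - complex_extension D (conjC (L q))"
    using lie_bracketC_eq[OF assms(1-5), of L "conjC \<circ> L" E D "\<lambda>x. conjC (E x)" "\<lambda>v. conjC (D v)"]
      L(1) E conj[OF E(2)] q conjC_in_CT[OF T] by simp
  have W': "lie_bracketC S L' (conjC \<circ> L') q =
      complex_extension (\<lambda>v. conjC (?D' v)) (L' q) - complex_extension ?D' (conjC (L' q))"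
    using lie_bracketC_eq[OF assms(1-5), of L' "conjC \<circ> L'" ?E' ?D' "\<lambda>x. conjC (?E' x)" "\<lambda>v. conjC (?D' v)"]
      L(2) E(1) a(1) conj[OF E'] E' q conjC_in_CT[OF T] by simp
  \<comment> \<open>The derivative of \<open>cnj a\<close> along the complex vector
    \<open>L' q\<close>; its conjugate is the derivative of \<open>a\<close> along the conjugate
    vector.\<close>
  define \<gamma> where "\<gamma> = cnj (a' (fst (L' q))) + \<i> * cnj (a' (snd (L' q)))"
  have "a' (- v) = - a' v" for v
    using lin(2) by (rule linear_neg)
  then have "complex_extension ?D' (conjC (L' q)) = a q *\<^sub>C complex_extension D (conjC (L' q)) + cnj \<gamma> *\<^sub>C L q"
    by (simp add: complex_extension_def conjC_def \<gamma>_def q(2) cpx.scale_right_distrib cpx.scale_left_distrib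
        cpx.scale_left_diff_distrib cpx.scale_right_diff_distrib mult.commute)
  moreover have "complex_extension (\<lambda>v. conjC (?D' v)) (L' q) =
      cnj (a q) *\<^sub>C complex_extension (\<lambda>v. conjC (D v)) (L' q) + \<gamma> *\<^sub>C conjC (L q)"
  proof -
    have "conjC (?D' v) = cnj (a q) *\<^sub>C conjC (D v) + cnj (a' v) *\<^sub>C conjC (L q)" for v
      by (simp add: conjC_add conjC_scaleC q(2))
    then show ?thesis
      by (simp add: complex_extension_def \<gamma>_def cpx.scale_right_distrib cpx.scale_left_distrib mult.commute)
  qed
  moreover have "L' q = a q *\<^sub>C L q" by (rule a(1)[OF q(1)])
  ultimately have "lie_bracketC S L' (conjC \<circ> L') q =
    (a q * cnj (a q)) *\<^sub>C lie_bracketC S L (conjC \<circ> L) q + \<gamma> *\<^sub>C conjC (L q) - cnj \<gamma> *\<^sub>C L q"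
    unfolding W W'
    by (simp add: complex_extension_scaleC lin conjC_scaleC cpx.scale_right_diff_distrib mult.commute)
  then show thesis by (rule that)
qed

lemma local_generator_transition:
  assumes sub: "submanifold \<kappa> 3 M" and "at_least_C 2 \<kappa>"
    and L: "local_generator \<kappa> M V L" "local_generator \<kappa> M V L'" and q: "q \<in> V"
  obtains a \<gamma> where "a \<noteq> 0" "L' q = a *\<^sub>C L q" "lie_bracketC M L' (conjC \<circ> L') q =
    (a * cnj a) *\<^sub>C lie_bracketC M L (conjC \<circ> L) q + \<gamma> *\<^sub>C conjC (L q) - cnj \<gamma> *\<^sub>C L q"
proof -
  have \<kappa>: "at_least_C 1 \<kappa>" "at_least_C 1 (lose_derivs 1 \<kappa>)"
    using at_least_C_mono[OF assms(2)] at_least_C_lose_derivs[of 1 1 \<kappa>] assms(2) by (auto simp: numeral_eq_Suc)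
  obtain U1 E where E: "open U1" "q \<in> U1" "M \<inter> U1 \<subseteq> V" "of_class (lose_derivs 1 \<kappa>) E U1"
    "\<And>x. x \<in> M \<inter> U1 \<Longrightarrow> E x = L x"
    by (rule local_generator_extension[OF L(1) q]) (rule that)
  obtain U2 E' where E': "open U2" "q \<in> U2" "M \<inter> U2 \<subseteq> V" "of_class (lose_derivs 1 \<kappa>) E' U2"
    "\<And>x. x \<in> M \<inter> U2 \<Longrightarrow> E' x = L' x"
    by (rule local_generator_extension[OF L(2) q]) (rule that)
  have qM: "q \<in> M" by (rule local_generatorD(1)[OF L(1) q])
  have "fst (L q) \<noteq> 0"
    by (rule local_generator_complex_line(1)[OF sub \<kappa>(1) L(1) q])
  then obtain j where j: "fst (L q) $ j \<noteq> 0"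
    by (auto simp: vec_eq_iff)
  define f where "f = (\<lambda>v :: (complex^2) complexified. fst v $ j)"
  have f: "bounded_linear f"
    unfolding f_def by (rule bounded_linear_compose[OF bounded_linear_vec_nth bounded_linear_fst])
  define a where "a x = f (E' x) / f (E x)" for x
  \<comment> \<open>Shrunk so that the denominator of \<open>a\<close> has no zero.\<close>
  define U where "U = (U1 \<inter> (\<lambda>x. f (E x)) -` (- {0})) \<inter> U2"
  have "continuous_on U1 (\<lambda>x. f (E x))"
    using of_class_imp_Ck_on[OF of_class_bounded_linear[OF f E(4)] \<kappa>(2)] by (rule Ck_on_imp_continuous_on)
  then have "open U"
    unfolding U_def using E(1) E'(1) by (intro open_Int continuous_open_preimage) auto
  have "q \<in> U"
    using E(2,5) E'(2) qM j by (simp add: U_def f_def)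
  have transition: "L' x = a x *\<^sub>C L x" if "x \<in> M \<inter> U" for x
  proof -
    have x: "x \<in> M" "x \<in> V" "E x = L x" "E' x = L' x" "fst (L x) $ j \<noteq> 0"
      using that E(3,5) E'(5) by (auto simp: U_def f_def)
    have "fst (L' x) = a x *s fst (L x)"
      unfolding a_def f_def x(3,4)
      by (rule complex_line_in_real_hyperplane[OF subspace_tangent_space[OF sub \<kappa>(1) x(1)]])
        (use x local_generator_complex_line[OF sub \<kappa>(1)] L in auto)
    \<comment> \<open>The imaginary parts follow, each being \<open>- \<i>\<close> times the real
      part.\<close>
    then show ?thesis
      using local_generatorD(4)[OF L(1) x(2)] local_generatorD(4)[OF L(2) x(2)]
      by (simp add: prod_eq_iff scaleC_def vec_eq_iff complex_eq_iff)
  qed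
  have D: "(E has_derivative frechet_derivative E (at q)) (at q)"
    "(E' has_derivative frechet_derivative E' (at q)) (at q)"
    using of_class_differentiable[OF E(4) \<kappa>(2) E(2)] of_class_differentiable[OF E'(4) \<kappa>(2) E'(2)] .
  have "f (E q) \<noteq> 0"
    using \<open>q \<in> U\<close> by (simp add: U_def)
  then obtain a' where a': "(a has_derivative a') (at q)"
    unfolding a_def[abs_def]
    using has_derivative_divide'[OF bounded_linear.has_derivative[OF f D(2)] bounded_linear.has_derivative[OF f D(1)]]
    by blast
  have CT: "L x \<in> CT M x" "L' x \<in> CT M x" if "x \<in> M \<inter> U" for x
    using that E(3) local_generatorD(2)[OF L(1), of x] local_generatorD(2)[OF L(2), of x] by (auto simp: U_def)
  obtain \<gamma> where \<gamma>: "lie_bracketC M L' (conjC \<circ> L') q =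
    (a q * cnj (a q)) *\<^sub>C lie_bracketC M L (conjC \<circ> L) q + \<gamma> *\<^sub>C conjC (L q) - cnj \<gamma> *\<^sub>C L q"
    by (rule lie_bracketC_conj_rescale[OF sub \<kappa>(1) qM \<open>open U\<close> \<open>q \<in> U\<close> CT _ D(1) transition a'])
      (use E(5) in \<open>auto simp: U_def\<close>)
  have Lq: "L' q = a q *\<^sub>C L q"
    using transition qM \<open>q \<in> U\<close> by blast
  then have "a q \<noteq> 0"
    using local_generatorD(3)[OF L(2) q] by auto
  then show thesis
    using Lq \<gamma> by (rule that)
qed

lemma cr_frames_reduce_to_G_I_initial:
  assumes "real_hypersurface \<kappa> M" "at_least_C 2 \<kappa>"
  shows "cr_frames_reduce_to \<kappa> M G_I_initial"
  unfolding cr_frames_reduce_to_def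
proof (intro conjI allI impI closed_subgroup_G_I_initial)
  fix V L L' assume L: "local_generator \<kappa> M V L \<and> local_generator \<kappa> M V L'"
  have "\<exists>g. g \<in> G_I_initial \<and> cr_frame M L' q = matrix_frame_mult g (cr_frame M L q)" if q: "q \<in> V" for q
  proof -
    have sub: "submanifold \<kappa> 3 M"
      using assms(1) by (simp add: real_hypersurface_def)
    obtain a \<gamma> where a: "a \<noteq> 0" "L' q = a *\<^sub>C L q" "lie_bracketC M L' (conjC \<circ> L') q =
      (a * cnj a) *\<^sub>C lie_bracketC M L (conjC \<circ> L) q + \<gamma> *\<^sub>C conjC (L q) - cnj \<gamma> *\<^sub>C L q"
      by (rule local_generator_transition[OF sub assms(2) conjunct1[OF L] conjunct2[OF L] q]) (rule that)
    \<comment> \<open>Its conjugate is \<open>\<i> * \<gamma>\<close>; multiplying the two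
      correction terms of the bracket by \<i> thus gives \<open>b\<close> and \<open>cnj b\<close>
      as coefficients of \<open>L\<close> and of its conjugate.\<close>
    define b where "b = - (\<i> * cnj \<gamma>)"
    define g :: "complex^3^3" where
      "g = vector [vector [a, 0, 0], vector [0, cnj a, 0], vector [b, cnj b, a * cnj a]]"
    have "\<i> *\<^sub>C lie_bracketC M L' (conjC \<circ> L') q =
      b *\<^sub>C L q + cnj b *\<^sub>C conjC (L q) + (a * cnj a) *\<^sub>C (\<i> *\<^sub>C lie_bracketC M L (conjC \<circ> L) q)"
      unfolding a(3) b_def
      by (simp add: cpx.scale_right_distrib cpx.scale_right_diff_distrib mult.commute)
    then have "cr_frame M L' q = matrix_frame_mult g (cr_frame M L q)"
      by (simp add: vec_eq_iff forall_3 matrix_frame_mult_def sum_3 cr_frame_def g_def a(2) conjC_scaleC)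
    moreover have "g \<in> G_I_initial"
      using a(1) unfolding G_I_initial_def g_def by blast
    ultimately show ?thesis by blast
  qed
  then show "\<exists>g. \<forall>q\<in>V. g q \<in> G_I_initial \<and> cr_frame M L' q = matrix_frame_mult (g q) (cr_frame M L q)"
    by metis
qed

theorem mainTheorem1:
  fixes M :: "(complex^2) set" and \<kappa> :: smoothness
  assumes "at_least_C 3 \<kappa>"
    and "real_hypersurface \<kappa> M"
    and "connected M"
    and "general_class_I \<kappa> M"
  shows "(\<forall>V L. local_generator \<kappa> M V L \<longrightarrow> local_frame (lose_derivs 2 \<kappa>) M V (cr_frame M L)) \<and>
    cr_frames_reduce_to \<kappa> M G_I_initial \<and>
    submanifold C_infinity 4 G_I_initial"
proof (intro conjI allI impI)
  show "local_frame (lose_derivs 2 \<kappa>) M V (cr_frame M L)" if "local_generator \<kappa> M V L" for V L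
    using cr_frame_local_frame[OF assms(1,2,4) that] .
  show "cr_frames_reduce_to \<kappa> M G_I_initial"
    using cr_frames_reduce_to_G_I_initial[OF assms(2)] at_least_C_mono[OF assms(1)] by simp
qed (rule submanifold_G_I_initial)

end
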